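(* Let $m>1$ and $\Lambda_0\ge 1$. There is a constant $C>0$, depending only on $m$ and $\Lambda_0$, such that the following holds. Let $\bar u:\mathbb{R}\to\mathbb{R}$ be continuous and non-negative, with compact support $[a,b]$, positive on $(a,b)$, and with $\int_a^b\bar u(x)\,dx=1$. Let $K\ge2$ and let $0=\xi_0<\xi_1<\dots<\xi_K=1$ be a mesh whose mesh ratio $\Lambda$ (defined in the context) equals $\Lambda_0$. Let $a=\bar x_0<\bar x_1<\dots<\bar x_K=b$ be determined by $$\int_{\bar x_0}^{\bar x_k}\bar u(x)\,dx=\xi_k\qquad\text{for }k=0,1,\dots,K,$$ and let $x(t)=(x_0(t),\dots,x_K(t))$, $t\ge0$, be the solution of the discretized porous medium equation with exponent $m$ (defined in the context) with initial data $x_k(0)=\bar x_k$ for all $k$. If $$\bar b:=\sup_{\ell\in(a,b)}\frac{\int_{\bar x_0}^{\ell}\bar u(x)^m\,dx}{\left(\int_{\bar x_0}^{\ell}\bar u(x)\,dx\right)^{\frac{3m-1}{m+1}}}<\infty,$$ then $$|x_0(t)-\bar x_0|\le 2\,\delta_{1/2}^{\frac{m-1}{m+1}}\sqrt{\bar b\,t}\qquad\text{for all } 0\le t\le C\,\bar b^{-\frac{m+1}{m-1}},$$ where $\delta_{1/2}=\xi_1-\xi_0=\xi_1$.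
   Context: Mesh. Given $0=\xi_0<\xi_1<\dots<\xi_K=1$, put $\delta_\kappa:=\xi_{\kappa+1/2}-\xi_{\kappa-1/2}$ for half-integers $\kappa\in\{1/2,3/2,\dots,K-1/2\}$, $\delta_{-1/2}=\delta_{K+1/2}:=0$, and $\delta_k:=\frac12(\delta_{k+1/2}+\delta_{k-1/2})$ for integers $k=0,\dots,K$ (so $\delta_0=\xi_1/2$). The mesh ratio is $$\Lambda:=\max\Big\{\max_{1\le k\le K-1}\frac{\delta_{k+1/2}}{\delta_{k-1/2}},\ \max_{1\le k\le K-1}\frac{\delta_{k-1/2}}{\delta_{k+1/2}}\Big\}.$$ Discretized porous medium equation. A solution is a differentiable curve $x(t)=(x_0(t),\dots,x_K(t))\in\mathbb{R}^{K+1}$ with $x_0(t)<x_1(t)<\dots<x_K(t)$ such that, with the densities $$z_\kappa(t):=\frac{\xi_{\kappa+1/2}-\xi_{\kappa-1/2}}{x_{\kappa+1/2}(t)-x_{\kappa-1/2}(t)}\quad\text{for }\kappa=1/2,\dots,K-1/2,\qquad z_{-1/2}(t)=z_{K+1/2}(t)=0,$$ one has $$\dot x_k(t)=-\frac{z_{k+1/2}(t)^m-z_{k-1/2}(t)^m}{\delta_k}\qquad\text{for }k=0,1,\dots,K.$$ *)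

theory Defs
  imports "HOL-Analysis.Analysis"
begin

text \<open>Quantities living on half-integers are indexed by naturals with a shift by one half:
  index \<open>j\<close> stands for \<open>j - 1/2\<close>. Thus the index \<open>k\<close> gives the value at \<open>k - 1/2\<close> and
  \<open>Suc k\<close> the value at \<open>k + 1/2\<close>; the cells of the mesh are \<open>j = 1, ..., K\<close>, and \<open>j = 0\<close> and
  \<open>j = K + 1\<close> are the fictitious cells outside, where the value is zero by convention.\<close>

definition is_mesh :: "nat \<Rightarrow> (nat \<Rightarrow> real) \<Rightarrow> bool" where
  "is_mesh K \<xi> \<longleftrightarrow> \<xi> 0 = 0 \<and> \<xi> K = 1 \<and> (\<forall>k<K. \<xi> k < \<xi> (Suc k))"

definition half_width :: "nat \<Rightarrow> (nat \<Rightarrow> real) \<Rightarrow> nat \<Rightarrow> real" where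
  "half_width K \<xi> j = (if 1 \<le> j \<and> j \<le> K then \<xi> j - \<xi> (j - 1) else 0)"

definition node_width :: "nat \<Rightarrow> (nat \<Rightarrow> real) \<Rightarrow> nat \<Rightarrow> real" where
  "node_width K \<xi> k = (half_width K \<xi> (Suc k) + half_width K \<xi> k) / 2"

text \<open>The maxima are over a nonempty index set only for \<open>K \<ge> 2\<close>.\<close>

definition mesh_ratio :: "nat \<Rightarrow> (nat \<Rightarrow> real) \<Rightarrow> real" where
  "mesh_ratio K \<xi> =
     max (Max ((\<lambda>k. half_width K \<xi> (Suc k) / half_width K \<xi> k) ` {1..K - 1}))
         (Max ((\<lambda>k. half_width K \<xi> k / half_width K \<xi> (Suc k)) ` {1..K - 1}))"

definition density :: "nat \<Rightarrow> (nat \<Rightarrow> real) \<Rightarrow> (nat \<Rightarrow> real) \<Rightarrow> nat \<Rightarrow> real" where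
  "density K \<xi> y j =
     (if 1 \<le> j \<and> j \<le> K then (\<xi> j - \<xi> (j - 1)) / (y j - y (j - 1)) else 0)"

text \<open>Global solutions on \<open>t \<ge> 0\<close>; the derivative at \<open>t = 0\<close> is one-sided. Only the components
  \<open>0, ..., K\<close> of \<open>x t\<close> are relevant.\<close>

definition discrete_pme_solution ::
    "real \<Rightarrow> nat \<Rightarrow> (nat \<Rightarrow> real) \<Rightarrow> (real \<Rightarrow> nat \<Rightarrow> real) \<Rightarrow> bool" where
  "discrete_pme_solution m K \<xi> x \<longleftrightarrow>
     (\<forall>t\<ge>0. (\<forall>k<K. x t k < x t (Suc k)) \<and>
       (\<forall>k\<le>K. ((\<lambda>s. x s k) has_real_derivative
          - ((density K \<xi> (x t) (Suc k) powr m - density K \<xi> (x t) k powr m) / node_width K \<xi> k))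
          (at t within {0..})))"

definition moment_ratio :: "real \<Rightarrow> (real \<Rightarrow> real) \<Rightarrow> real \<Rightarrow> real \<Rightarrow> real" where
  "moment_ratio m u a l =
     integral {a..l} (\<lambda>x. u x powr m) / (integral {a..l} u) powr ((3 * m - 1) / (m + 1))"

end

theory Submission
  imports Defs
begin

text \<open>Since \<open>x 0\<close> moves with speed \<open>2 z\<^sup>m / \<xi> 1\<close>, where \<open>z\<close> is the density in the first cell, it
  suffices to bound \<open>z\<close> by a multiple of \<open>b powr (1 / (m - 1)) * \<xi> 1 powr (2 / (m + 1))\<close>, uniformly
  in time. This comes from local energy estimates. Let \<open>E\<^sub>R\<close> be the sum over the cells of
  \<open>d \<eta>\<^sup>2 z powr (m - 1)\<close>, with \<open>d\<close> the cell width and \<open>\<eta>\<close> a cutoff living on \<open>\<xi> \<le> R\<close>. Its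
  derivative is \<open>m - 1\<close> times the difference of a cutoff error and a dissipation, and a discrete
  Gagliardo--Nirenberg inequality bounds the error by a small multiple of the dissipation at the
  scale \<open>M R\<close> plus a remainder, where \<open>M\<close> depends only on the mesh ratio. With
  \<open>\<alpha> = (3 m - 1) / (m + 1)\<close>, the bound \<open>E\<^sub>R \<le> B b R\<^sup>\<alpha>\<close> (and the same for the time integral of the
  dissipation) is invariant under the scaling of the equation, so on the stated time interval it
  propagates from \<open>M R\<close> to \<open>R\<close>: start at \<open>R \<ge> 1\<close>, where there is no cutoff error, and
  descend to \<open>R = \<xi> 1\<close>.\<close>

subsection \<open>Energy inequalities on a mesh\<close>

text \<open>A mean value bound for \<open>s powr (1 + q/2)\<close>: its derivative is at most twice
  the larger argument to the power \<open>q/2\<close>, because \<open>1 + q/2 \<le> 2\<close>. The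
  right-hand side is symmetric so that it can be summed node by node in
  \<open>interpolation\<close>.\<close>

lemma powr_diff_sq_le:
  fixes a b q :: real
  assumes "0 \<le> a" "0 \<le> b" "0 < q" "q \<le> 2"
  shows "(a powr (1 + q/2) - b powr (1 + q/2))\<^sup>2 \<le> 4 * (a powr q + b powr q) * (a - b)\<^sup>2"
  using assms
proof (induction a b rule: linorder_wlog)
  case (sym a b)
  then show ?case by (simp add: power2_commute add.commute)
next
  case (le b a)
  show ?case
  proof (cases "a = 0")
    case True
    then show ?thesis using le by simp
  next
    case False
    define P where "P = a powr (q/2)"
    define Q where "Q = b powr (q/2)"
    have a: "a > 0" using False le by simp
    have P0: "P > 0" and Q0: "Q \<ge> 0" using a by (auto simp: P_def Q_def)
    have aP: "a powr (1 + q/2) = a * P" and bQ: "b powr (1 + q/2) = b * Q"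
      using le by (auto simp: P_def Q_def powr_mult_base)
    have PP: "P\<^sup>2 = a powr q" using a by (simp add: P_def power2_eq_square flip: powr_add)
    have QP: "Q \<le> P" unfolding P_def Q_def using le by (intro powr_mono2) auto
    \<comment> \<open>This is the monotonicity of \<open>s powr (q/2 - 1)\<close>, nonincreasing as
      \<open>q \<le> 2\<close>. Expanding \<open>P * (a - b)\<^sup>2 \<ge> 0\<close> and inserting
      it yields the mean value bound without differentiation.\<close>
    have key: "b * P \<le> a * Q"
    proof (cases "b = 0")
      case False
      then have b: "b > 0" using le by simp
      have "(b/a) powr 1 \<le> (b/a) powr (q/2)"
        by (rule powr_mono') (use a b le in auto)
      then have "b / a \<le> Q / P"
        using a b by (simp add: P_def Q_def powr_divide)
      then show ?thesis using a P0 by (simp add: field_simps)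
    qed (use a Q0 in auto)
    have 1: "0 \<le> a * P - b * Q" using QP le Q0 P0 by (simp add: mult_mono)
    have "0 \<le> P * (a - b)\<^sup>2" using P0 by simp
    also have "\<dots> = a * (a * P) + b * (b * P) - 2 * a * b * P"
      by (simp add: power2_eq_square algebra_simps)
    also have "\<dots> \<le> a * (a * P) + b * (a * Q) - 2 * a * b * P"
      using mult_left_mono[OF key] le by simp
    also have "\<dots> = a * (2 * P * (a - b) - (a * P - b * Q))" by (simp add: algebra_simps)
    finally have 2: "a * P - b * Q \<le> 2 * P * (a - b)"
      using a by (simp add: zero_le_mult_iff)
    have "(a * P - b * Q)\<^sup>2 \<le> (2 * P * (a - b))\<^sup>2"
      using 1 2 by (intro power_mono)
    also have "\<dots> = 4 * (a powr q) * (a - b)\<^sup>2" by (simp add: power_mult_distrib PP)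
    also have "\<dots> \<le> 4 * (a powr q + b powr q) * (a - b)\<^sup>2"
      by (intro mult_right_mono) auto
    finally have "(a * P - b * Q)\<^sup>2 \<le> 4 * (a powr q + b powr q) * (a - b)\<^sup>2" .
    then show ?thesis unfolding aP bQ by (simp add: power2_commute add.commute)
  qed
qed

text \<open>For a density, the cell width in mass is \<open>z j\<close> times the cell length in
  space. The sum is therefore the integral of the m-th power of the piecewise constant density over
  space, weighted by the squared cutoff.\<close>

definition energy :: "real \<Rightarrow> nat \<Rightarrow> (nat \<Rightarrow> real) \<Rightarrow> (nat \<Rightarrow> real) \<Rightarrow> (nat \<Rightarrow> real) \<Rightarrow> real" where
  "energy m K \<xi> \<eta> z = (\<Sum>j=1..K. half_width K \<xi> j * (\<eta> j)\<^sup>2 * z j powr (m - 1))"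

definition dissipation :: "real \<Rightarrow> nat \<Rightarrow> (nat \<Rightarrow> real) \<Rightarrow> (nat \<Rightarrow> real) \<Rightarrow> (nat \<Rightarrow> real) \<Rightarrow> real" where
  "dissipation m K \<xi> \<eta> z =
     (\<Sum>k\<le>K. (\<eta> (Suc k) * z (Suc k) powr m - \<eta> k * z k powr m)\<^sup>2 / node_width K \<xi> k)"

text \<open>The defect left when the cutoff is moved inside the difference in
  \<open>dissipation\<close>: for values f, g of \<open>z\<^sup>m\<close> and A, B of the cutoff,
  (A^2 f - B^2 g)(f - g) = (A f - B g)^2 - f g (A - B)^2.\<close>

definition cutoff_error :: "real \<Rightarrow> nat \<Rightarrow> (nat \<Rightarrow> real) \<Rightarrow> (nat \<Rightarrow> real) \<Rightarrow> (nat \<Rightarrow> real) \<Rightarrow> real" where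
  "cutoff_error m K \<xi> \<eta> z =
     (\<Sum>k\<le>K. z k powr m * z (Suc k) powr m * (\<eta> (Suc k) - \<eta> k)\<^sup>2 / node_width K \<xi> k)"

text \<open>For \<open>R \<ge> 1\<close> the cutoff is switched off, so that the descent in \<open>R\<close> has a base case.\<close>

definition cutoff :: "(nat \<Rightarrow> real) \<Rightarrow> real \<Rightarrow> nat \<Rightarrow> real" where
  "cutoff \<xi> R j = (if R \<ge> 1 then 1 else max 0 (1 - \<xi> (j - 1) / R))"

section \<open>Geometry of meshes with bounded ratio of neighbouring cells\<close>

locale mesh =
  fixes K :: nat and \<xi> :: "nat \<Rightarrow> real" and \<Lambda> :: real
  assumes mesh: "is_mesh K \<xi>"
    and ratio_up: "\<And>k. 1 \<le> k \<Longrightarrow> k < K \<Longrightarrow> half_width K \<xi> (Suc k) \<le> \<Lambda> * half_width K \<xi> k"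
    and ratio_down: "\<And>k. 1 \<le> k \<Longrightarrow> k < K \<Longrightarrow> half_width K \<xi> k \<le> \<Lambda> * half_width K \<xi> (Suc k)"
    and ratio_ge_1: "1 \<le> \<Lambda>"
begin

abbreviation "d \<equiv> half_width K \<xi>"
abbreviation "\<delta> \<equiv> node_width K \<xi>"

lemma xi_0: "\<xi> 0 = 0" and xi_K: "\<xi> K = 1" and xi_less: "k < K \<Longrightarrow> \<xi> k < \<xi> (Suc k)"
  using mesh by (auto simp: is_mesh_def)

lemma xi_mono: "i \<le> j \<Longrightarrow> j \<le> K \<Longrightarrow> \<xi> i \<le> \<xi> j"
proof (induction j rule: dec_induct)
  case (step n)
  then show ?case using xi_less[of n] by simp
qed simp

lemma xi_nonneg: "j \<le> K \<Longrightarrow> 0 \<le> \<xi> j"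
  using xi_mono[of 0 j] xi_0 by simp

lemma K_pos: "0 < K"
  using xi_0 xi_K by (cases K) auto

lemma d_pos: "1 \<le> j \<Longrightarrow> j \<le> K \<Longrightarrow> 0 < d j"
  using xi_less[of "j - 1"] by (auto simp: half_width_def)

lemma d_nonneg: "0 \<le> d j"
  using d_pos[of j] by (cases "1 \<le> j \<and> j \<le> K") (auto simp: half_width_def)

lemma d_Suc: "k < K \<Longrightarrow> d (Suc k) = \<xi> (Suc k) - \<xi> k"
  by (auto simp: half_width_def)

lemma node_width_pos: "k \<le> K \<Longrightarrow> 0 < \<delta> k"
  using d_pos[of k] d_pos[of "Suc k"] d_nonneg[of k] d_nonneg[of "Suc k"] K_pos
  by (cases "k = 0") (auto simp: node_width_def intro: add_pos_nonneg add_nonneg_pos)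

lemma node_width_ge: "d k / 2 \<le> \<delta> k"
  using d_nonneg[of "Suc k"] by (simp add: node_width_def)

lemma node_width_le:
  assumes "1 \<le> j" "j \<le> K"
  shows "\<delta> j \<le> (1 + \<Lambda>) / 2 * d j" "\<delta> (j - 1) \<le> (1 + \<Lambda>) / 2 * d j"
proof -
  have nn: "0 \<le> \<Lambda> * d j" using ratio_ge_1 d_nonneg[of j] by simp
  have "d (Suc j) \<le> \<Lambda> * d j"
    using ratio_up[of j] assms nn by (cases "j < K") (auto simp: half_width_def)
  then show "\<delta> j \<le> (1 + \<Lambda>) / 2 * d j" by (simp add: node_width_def field_simps)
  have "d (j - 1) \<le> \<Lambda> * d j"
    using ratio_down[of "j - 1"] assms nn by (cases "1 < j") (auto simp: half_width_def)
  then show "\<delta> (j - 1) \<le> (1 + \<Lambda>) / 2 * d j" using assms by (simp add: node_width_def field_simps)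
qed

text \<open>A cell is at most \<open>\<Lambda>\<close> times as wide as its left neighbour, which
  lies in the part of the mesh already passed. The first cell has no left neighbour, whence the
  assumption \<open>\<xi> 1 \<le> R\<close>.\<close>

lemma xi_step:
  assumes "1 \<le> k" "k \<le> K" "\<xi> (k - 1) \<le> R" "\<xi> 1 \<le> R"
  shows "\<xi> k \<le> (1 + \<Lambda>) * R"
proof (cases "k = 1")
  case True
  then show ?thesis using assms ratio_ge_1 xi_nonneg[of 1] mult_right_mono[of 1 "1 + \<Lambda>" R] by simp
next
  case False
  define i where "i = k - 1"
  have i: "k = Suc i" "1 \<le> i" "i < K" using False assms by (auto simp: i_def)
  have "d k \<le> \<Lambda> * d i" using ratio_up i by simp
  also have "\<dots> \<le> \<Lambda> * \<xi> i"
    using ratio_ge_1 i xi_nonneg[of "i - 1"] by (intro mult_left_mono) (auto simp: half_width_def)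
  finally have "\<xi> k \<le> (1 + \<Lambda>) * \<xi> i" using i d_Suc[of i] by (simp add: algebra_simps)
  also have "\<dots> \<le> (1 + \<Lambda>) * R" using assms i ratio_ge_1 by (intro mult_left_mono) auto
  finally show ?thesis .
qed

lemma energy_nonneg: "0 \<le> energy m K \<xi> \<eta> z"
  unfolding energy_def by (intro sum_nonneg mult_nonneg_nonneg d_nonneg) auto

lemma dissipation_nonneg: "0 \<le> dissipation m K \<xi> \<eta> z"
  unfolding dissipation_def by (intro sum_nonneg divide_nonneg_pos node_width_pos) auto

text \<open>A discrete Gagliardo--Nirenberg inequality. The vanishing boundary value \<open>z 0\<close> allows to write
  \<open>(\<eta> z\<^sup>m) powr (1 + q/2)\<close> as a telescoping sum; \<open>q = (m - 1) / m\<close> makes \<open>(z\<^sup>m)\<^sup>q\<close> the energy density.\<close>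

lemma interpolation:
  assumes m: "1 < m" and j: "1 \<le> j" "j \<le> K" and z: "\<And>i. 0 \<le> z i" "z 0 = 0"
    and \<eta>: "\<And>i. 1 \<le> i \<Longrightarrow> i \<le> j \<Longrightarrow> 1/2 \<le> \<eta> i \<and> \<eta> i \<le> 1"
  shows "z j powr (3*m - 1) \<le> 128 * (1 + \<Lambda>) * energy m K \<xi> \<eta> z * dissipation m K \<xi> \<eta> z"
proof -
  define q where "q = (m - 1) / m"
  have q: "0 < q" "q < 1" using m by (auto simp: q_def)
  define h where "h i = \<eta> i * z i powr m" for i
  have h0: "h 0 = 0" using z by (simp add: h_def)
  have hnn: "0 \<le> h i" if "i \<le> j" for i
    using that \<eta>[of i] h0 by (cases "i = 0") (auto simp: h_def)
  have hq: "h i powr q \<le> z i powr (m - 1)" if "i \<le> j" for i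
  proof (cases "i = 0")
    case False
    then have "h i \<le> z i powr m" using \<eta>[of i] that mult_right_mono[of "\<eta> i" 1 "z i powr m"] by (simp add: h_def)
    then have "h i powr q \<le> (z i powr m) powr q" using hnn that q by (intro powr_mono2) auto
    then show ?thesis using m by (simp add: powr_powr q_def)
  qed (use h0 in simp)
  define g where "g i = h i powr q + h (Suc i) powr q" for i
  define D where "D = dissipation m K \<xi> \<eta> z"
  define E where "E = energy m K \<xi> \<eta> z"
  \<comment> \<open>Adding the term of index \<open>j\<close> and shifting by one, with
    \<open>h 0 = 0\<close>, puts both halves on the same cells. The two adjacent node widths cost
    \<open>1 + \<Lambda>\<close>, and the 4 compensates \<open>\<eta> \<ge> 1/2\<close> in the
    energy.\<close>
  have sumg: "(\<Sum>i<j. \<delta> i * g i) \<le> 4 * (1 + \<Lambda>) * E"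
  proof -
    have "(\<Sum>i<j. \<delta> i * g i) = (\<Sum>i<j. \<delta> i * h i powr q) + (\<Sum>i<j. \<delta> i * h (Suc i) powr q)"
      by (simp add: g_def distrib_left sum.distrib)
    also have "(\<Sum>i<j. \<delta> i * h i powr q) \<le> (\<Sum>i<Suc j. \<delta> i * h i powr q)"
      using node_width_pos[of j] j by simp
    also have "\<dots> = (\<Sum>i<j. \<delta> (Suc i) * h (Suc i) powr q)"
      by (subst sum.lessThan_Suc_shift) (simp add: h0)
    also have "(\<Sum>i<j. \<delta> (Suc i) * h (Suc i) powr q) + (\<Sum>i<j. \<delta> i * h (Suc i) powr q)
        = (\<Sum>i<j. (\<delta> (Suc i) + \<delta> i) * h (Suc i) powr q)"
      by (simp add: distrib_right sum.distrib)
    also have "\<dots> \<le> (\<Sum>i<j. 4 * (1 + \<Lambda>) * (d (Suc i) * (\<eta> (Suc i))\<^sup>2 * z (Suc i) powr (m - 1)))"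
    proof (rule sum_mono)
      fix i assume "i \<in> {..<j}"
      then have i: "Suc i \<le> j" by simp
      have "\<delta> (Suc i) + \<delta> i \<le> (1 + \<Lambda>) * d (Suc i)"
        using node_width_le[of "Suc i"] i j by (simp add: field_simps)
      then have "(\<delta> (Suc i) + \<delta> i) * h (Suc i) powr q \<le> ((1 + \<Lambda>) * d (Suc i)) * z (Suc i) powr (m - 1)"
        using hq[OF i] d_nonneg[of "Suc i"] ratio_ge_1 by (intro mult_mono) auto
      also have "\<dots> \<le> ((1 + \<Lambda>) * d (Suc i)) * (4 * (\<eta> (Suc i))\<^sup>2 * z (Suc i) powr (m - 1))"
      proof (intro mult_left_mono)
        have "(1/2)\<^sup>2 \<le> (\<eta> (Suc i))\<^sup>2" using \<eta>[of "Suc i"] i by (intro power_mono) auto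
        then have "1 \<le> 4 * (\<eta> (Suc i))\<^sup>2" by (simp add: power2_eq_square)
        then show "z (Suc i) powr (m - 1) \<le> 4 * (\<eta> (Suc i))\<^sup>2 * z (Suc i) powr (m - 1)"
          using mult_right_mono[of 1 "4 * (\<eta> (Suc i))\<^sup>2" "z (Suc i) powr (m - 1)"] by simp
      qed (use d_nonneg[of "Suc i"] ratio_ge_1 in auto)
      finally show "(\<delta> (Suc i) + \<delta> i) * h (Suc i) powr q
          \<le> 4 * (1 + \<Lambda>) * (d (Suc i) * (\<eta> (Suc i))\<^sup>2 * z (Suc i) powr (m - 1))"
        by (simp add: algebra_simps)
    qed
    also have "\<dots> = 4 * (1 + \<Lambda>) * (\<Sum>i<j. d (Suc i) * (\<eta> (Suc i))\<^sup>2 * z (Suc i) powr (m - 1))"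
      by (simp add: sum_distrib_left)
    also have "(\<Sum>i<j. d (Suc i) * (\<eta> (Suc i))\<^sup>2 * z (Suc i) powr (m - 1))
        = (\<Sum>i=1..j. d i * (\<eta> i)\<^sup>2 * z i powr (m - 1))"
      by (rule sum.reindex_bij_witness[where i = "\<lambda>i. i - 1" and j = Suc]) auto
    also have "\<dots> \<le> E" unfolding E_def energy_def
      using j d_nonneg by (intro sum_mono2) auto
    finally show ?thesis using ratio_ge_1 by simp
  qed
  have sumD: "(\<Sum>i<j. (h (Suc i) - h i)\<^sup>2 / \<delta> i) \<le> D"
    unfolding D_def dissipation_def h_def
    using j node_width_pos by (intro sum_mono2) (auto intro!: divide_nonneg_pos)
  \<comment> \<open>Factors for Cauchy-Schwarz: the node width moves between them so that the
    squares of \<open>a\<close> sum to an energy and those of \<open>c\<close> to a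
    dissipation.\<close>
  define a where "a i = sqrt (4 * \<delta> i * g i)" for i
  define c where "c i = sqrt ((h (Suc i) - h i)\<^sup>2 / \<delta> i)" for i
  have diff: "h (Suc i) powr (1 + q/2) - h i powr (1 + q/2) \<le> a i * c i" if "i < j" for i
  proof -
    have \<delta>: "\<delta> i > 0" using that j node_width_pos by simp
    have "(h (Suc i) powr (1 + q/2) - h i powr (1 + q/2))\<^sup>2 \<le> 4 * g i * (h (Suc i) - h i)\<^sup>2"
      using powr_diff_sq_le[of "h (Suc i)" "h i" q] hnn[of i] hnn[of "Suc i"] that q
      by (simp add: g_def add.commute)
    also have "\<dots> = (4 * \<delta> i * g i) * ((h (Suc i) - h i)\<^sup>2 / \<delta> i)" using \<delta> by simp
    finally show ?thesis unfolding a_def c_def real_sqrt_mult[symmetric] by (rule real_le_rsqrt)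
  qed
  have nn: "0 \<le> h j powr (1 + q/2)" by simp
  have "h j powr (1 + q/2) = (\<Sum>i<j. h (Suc i) powr (1 + q/2) - h i powr (1 + q/2))"
    by (subst sum_lessThan_telescope) (simp add: h0)
  also have "\<dots> \<le> (\<Sum>i<j. a i * c i)" by (intro sum_mono diff) auto
  finally have "(h j powr (1 + q/2))\<^sup>2 \<le> (\<Sum>i<j. a i * c i)\<^sup>2" using nn by (intro power_mono)
  also have "\<dots> \<le> (\<Sum>i<j. (a i)\<^sup>2) * (\<Sum>i<j. (c i)\<^sup>2)" by (rule Cauchy_Schwarz_ineq_sum)
  also have "(\<Sum>i<j. (a i)\<^sup>2) = 4 * (\<Sum>i<j. \<delta> i * g i)"
    unfolding sum_distrib_left
  proof (intro sum.cong refl)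
    fix i assume "i \<in> {..<j}"
    then have "0 \<le> \<delta> i" "0 \<le> g i" using node_width_pos[of i] j by (auto simp: g_def)
    then show "(a i)\<^sup>2 = 4 * (\<delta> i * g i)" by (simp add: a_def)
  qed
  also have "(\<Sum>i<j. (c i)\<^sup>2) = (\<Sum>i<j. (h (Suc i) - h i)\<^sup>2 / \<delta> i)"
  proof (intro sum.cong refl)
    fix i assume "i \<in> {..<j}"
    then have "0 < \<delta> i" using node_width_pos[of i] j by auto
    then show "(c i)\<^sup>2 = (h (Suc i) - h i)\<^sup>2 / \<delta> i" by (simp add: c_def)
  qed
  also have "4 * (\<Sum>i<j. \<delta> i * g i) * (\<Sum>i<j. (h (Suc i) - h i)\<^sup>2 / \<delta> i) \<le> 4 * (4 * (1 + \<Lambda>) * E) * D"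
    using sumg sumD energy_nonneg ratio_ge_1 node_width_pos j
    by (intro mult_mono mult_left_mono sum_nonneg) (auto simp: E_def intro!: divide_nonneg_pos)
  finally have up: "(h j powr (1 + q/2))\<^sup>2 \<le> 16 * (1 + \<Lambda>) * E * D" by (simp add: algebra_simps)
  \<comment> \<open>To return from \<open>h j\<close> to \<open>z j\<close>, use that
    \<open>z j powr m\<close> is at most \<open>2 * h j\<close>. As \<open>2 + q \<le> 3\<close>
    this costs a factor 8, and 8 times 16 is the constant 128.\<close>
  have "m * (2 + q) = 3*m - 1" using m by (simp add: q_def field_simps)
  then have "z j powr (3*m - 1) = (z j powr m) powr (2 + q)" by (simp add: powr_powr)
  also have "\<dots> \<le> (2 * h j) powr (2 + q)"
    using \<eta>[of j] j q mult_right_mono[of 1 "2 * \<eta> j" "z j powr m"] by (intro powr_mono2) (auto simp: h_def)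
  also have "\<dots> = 2 powr (2 + q) * h j powr (2 + q)"
    using hnn[of j] by (simp add: powr_mult)
  also have "\<dots> \<le> 2 powr 3 * h j powr (2 + q)"
    using q by (intro mult_right_mono powr_mono) auto
  also have "\<dots> = 8 * (h j powr (1 + q/2))\<^sup>2"
    by (simp add: power2_eq_square flip: powr_add)
  also have "\<dots> \<le> 8 * (16 * (1 + \<Lambda>) * E * D)" using up by simp
  also have "\<dots> = 128 * (1 + \<Lambda>) * E * D" by (simp add: algebra_simps)
  finally show ?thesis unfolding E_def D_def .
qed

section \<open>Cutoffs and the error they cause\<close>

lemma cutoff_nonneg: "0 \<le> cutoff \<xi> R j"
  by (simp add: cutoff_def)

lemma cutoff_le_1: "0 < R \<Longrightarrow> j \<le> K \<Longrightarrow> cutoff \<xi> R j \<le> 1"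
  using xi_nonneg[of "j - 1"] by (simp add: cutoff_def)

lemma cutoff_ge_half: "0 < R \<Longrightarrow> \<xi> (j - 1) \<le> R / 2 \<Longrightarrow> 1/2 \<le> cutoff \<xi> R j"
  by (simp add: cutoff_def field_simps max_def)

text \<open>The cutoff samples the left end of a cell, so the first cell counts in full at every
  scale, in particular at \<open>R = \<xi> 1\<close>, where the descent ends.\<close>

lemma cutoff_1: "cutoff \<xi> R 1 = 1"
  by (simp add: cutoff_def xi_0)

lemma cutoff_diff_sq:
  assumes "1 \<le> k" "k < K" "0 < R"
  shows "(cutoff \<xi> R (Suc k) - cutoff \<xi> R k)\<^sup>2 \<le> (if \<xi> (k - 1) \<le> R then (d k)\<^sup>2 / R\<^sup>2 else 0)"
proof -
  have mono: "\<xi> (k - 1) \<le> \<xi> k" using xi_mono assms by simp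
  have dk: "d k = \<xi> k - \<xi> (k - 1)" using assms by (simp add: half_width_def)
  show ?thesis
  proof (cases "\<xi> (k - 1) \<le> R")
    case True
    have div: "\<xi> k / R = \<xi> (k - 1) / R + d k / R" by (simp add: dk flip: add_divide_distrib)
    have nn: "0 \<le> d k / R" using assms d_nonneg by simp
    have "\<bar>cutoff \<xi> R (Suc k) - cutoff \<xi> R k\<bar> \<le> d k / R"
      unfolding cutoff_def using nn div by (auto simp: max_def)
    then have "(cutoff \<xi> R (Suc k) - cutoff \<xi> R k)\<^sup>2 \<le> (d k / R)\<^sup>2"
      by (rule power2_le_iff_abs_le[THEN iffD2, OF nn])
    then show ?thesis using True by (simp add: power_divide)
  next
    case False
    then have "1 \<le> \<xi> (k - 1) / R" "1 \<le> \<xi> k / R" using assms mono by (auto simp: field_simps)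
    then show ?thesis using False by (auto simp: cutoff_def)
  qed
qed

text \<open>The product of neighbouring powers is split by f g \<open>\<le>\<close> (f^2 + g^2)/2.
  One factor of the squared cell width is absorbed by the node width, and \<open>\<Lambda>\<close>
  transfers the other to the right neighbour. That neighbour may start beyond \<open>R\<close>, but
  by \<open>xi_step\<close> not beyond \<open>(1 + \<Lambda>) * R\<close>.\<close>

lemma cutoff_error_le_sum:
  assumes R: "0 < R" "\<xi> 1 \<le> R" and z: "\<And>i. 0 \<le> z i" "z 0 = 0" "z (Suc K) = 0"
  shows "cutoff_error m K \<xi> (cutoff \<xi> R) z \<le>
    2 * \<Lambda> / R\<^sup>2 * (\<Sum>j | 1 \<le> j \<and> j \<le> K \<and> \<xi> (j - 1) \<le> (1 + \<Lambda>) * R. d j * z j powr (2 * m))"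
proof -
  define J where "J = {j. 1 \<le> j \<and> j \<le> K \<and> \<xi> (j - 1) \<le> (1 + \<Lambda>) * R}"
  define I where "I = {k. 1 \<le> k \<and> k < K \<and> \<xi> (k - 1) \<le> R}"
  define w where "w j = d j * z j powr (2 * m)" for j
  have finJ: "finite J" and finI: "finite I" by (auto simp: I_def J_def)
  have w: "0 \<le> w j" for j using d_nonneg by (simp add: w_def)
  have RR: "R \<le> (1 + \<Lambda>) * R" using R ratio_ge_1 by simp
  have summand: "z k powr m * z (Suc k) powr m * (cutoff \<xi> R (Suc k) - cutoff \<xi> R k)\<^sup>2 / \<delta> k
      \<le> (if k \<in> I then \<Lambda> / R\<^sup>2 * (w k + w (Suc k)) else 0)" if k: "k \<le> K" for k
  proof (cases "1 \<le> k \<and> k < K")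
    \<comment> \<open>At the two boundary nodes one of the adjacent densities is zero, so the
      summand vanishes.\<close>
    case False
    then have "k = 0 \<or> k = K" using k by auto
    then show ?thesis using z by (auto simp: I_def)
  next
    case True
    have \<delta>: "0 < \<delta> k" using node_width_pos True by simp
    show ?thesis
    proof (cases "k \<in> I")
      case False
      then show ?thesis using cutoff_diff_sq[of k R] True R by (simp add: I_def)
    next
      case kI: True
      define f g where "f = z k powr m" and "g = z (Suc k) powr m"
      have fg: "0 \<le> f * g" "2 * (f * g) \<le> f\<^sup>2 + g\<^sup>2"
        using sum_squares_bound[of f g] by (auto simp: f_def g_def algebra_simps)
      have f2: "f\<^sup>2 = z k powr (2*m)" "g\<^sup>2 = z (Suc k) powr (2*m)"
        by (auto simp: f_def g_def power2_eq_square simp flip: powr_add)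
      have ddk: "(d k)\<^sup>2 / \<delta> k \<le> 2 * d k"
      proof -
        have "d k * d k \<le> d k * (2 * \<delta> k)"
          using node_width_ge[of k] d_nonneg by (intro mult_left_mono) auto
        then show ?thesis using \<delta> by (simp add: field_simps power2_eq_square)
      qed
      have "f * g * (cutoff \<xi> R (Suc k) - cutoff \<xi> R k)\<^sup>2 / \<delta> k \<le> f * g * ((d k)\<^sup>2 / R\<^sup>2) / \<delta> k"
        using cutoff_diff_sq[of k R] True R kI fg \<delta>
        by (intro divide_right_mono mult_left_mono) (auto simp: I_def)
      also have "\<dots> = f * g / R\<^sup>2 * ((d k)\<^sup>2 / \<delta> k)" by simp
      also have "\<dots> \<le> f * g / R\<^sup>2 * (2 * d k)"
        using fg ddk by (intro mult_left_mono) auto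
      also have "\<dots> = 2 * (f * g) * (d k / R\<^sup>2)" by simp
      also have "\<dots> \<le> (f\<^sup>2 + g\<^sup>2) * (d k / R\<^sup>2)"
        using fg d_nonneg by (intro mult_right_mono) auto
      also have "\<dots> = (d k * f\<^sup>2 + d k * g\<^sup>2) / R\<^sup>2" by (simp add: field_simps)
      also have "\<dots> \<le> (\<Lambda> * d k * f\<^sup>2 + \<Lambda> * d (Suc k) * g\<^sup>2) / R\<^sup>2"
      proof (intro divide_right_mono add_mono mult_right_mono)
        show "d k \<le> \<Lambda> * d k" using ratio_ge_1 d_nonneg[of k] mult_right_mono[of 1 \<Lambda> "d k"] by simp
        show "d k \<le> \<Lambda> * d (Suc k)" using ratio_down True by simp
      qed auto
      also have "\<dots> = \<Lambda> / R\<^sup>2 * (w k + w (Suc k))" by (simp add: w_def f2 algebra_simps add_divide_distrib)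
      finally show ?thesis using kI by (simp add: f_def g_def)
    qed
  qed
  have "cutoff_error m K \<xi> (cutoff \<xi> R) z \<le> (\<Sum>k\<le>K. if k \<in> I then \<Lambda> / R\<^sup>2 * (w k + w (Suc k)) else 0)"
    unfolding cutoff_error_def by (intro sum_mono summand) auto
  also have "\<dots> = (\<Sum>k\<in>I. \<Lambda> / R\<^sup>2 * (w k + w (Suc k)))"
    by (intro sum.mono_neutral_cong_right) (auto simp: I_def)
  also have "\<dots> = \<Lambda> / R\<^sup>2 * ((\<Sum>k\<in>I. w k) + (\<Sum>k\<in>I. w (Suc k)))"
    by (simp only: sum_distrib_left sum.distrib distrib_left)
  also have "\<dots> \<le> \<Lambda> / R\<^sup>2 * ((\<Sum>j\<in>J. w j) + (\<Sum>j\<in>J. w j))"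
  proof (intro mult_left_mono add_mono)
    show "sum w I \<le> sum w J" using RR w finJ by (intro sum_mono2) (auto simp: I_def J_def)
    have "(\<Sum>k\<in>I. w (Suc k)) = sum w (Suc ` I)" by (simp add: sum.reindex)
    also have "\<dots> \<le> sum w J"
      using w finJ R xi_step by (intro sum_mono2) (auto simp: I_def J_def)
    finally show "(\<Sum>k\<in>I. w (Suc k)) \<le> sum w J" .
  qed (use ratio_ge_1 in auto)
  also have "\<dots> = 2 * \<Lambda> / R\<^sup>2 * sum w J" by simp
  finally show ?thesis unfolding J_def w_def .
qed

text \<open>Cells are split by the threshold \<open>\<zeta>\<close>. Below it,
  \<open>z powr (m + 1)\<close> is bounded directly; above it, a factor
  \<open>(z / \<zeta>) powr (2*m - 2) \<ge> 1\<close> raises the exponent to the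
  \<open>3*m - 1\<close> of \<open>interpolation\<close>. The larger scale makes
  \<open>\<eta>'\<close> at least 1/2 on every cell of the error sum. The choice of
  \<open>\<zeta>\<close> is left to \<open>energy_bound\<close>.\<close>

lemma cutoff_error_le:
  fixes m R Y \<zeta> :: real
  defines "\<eta>' \<equiv> cutoff \<xi> (2 * (1 + \<Lambda>) * R)"
  assumes m: "1 < m" and R: "0 < R" "\<xi> 1 \<le> R" and z: "\<And>i. 0 \<le> z i" "z 0 = 0" "z (Suc K) = 0"
    and Y: "energy m K \<xi> \<eta>' z \<le> Y" and \<zeta>: "0 < \<zeta>"
  shows "cutoff_error m K \<xi> (cutoff \<xi> R) z \<le> 8 * \<Lambda> * Y / R\<^sup>2 *
    (\<zeta> powr (m + 1) + 128 * (1 + \<Lambda>) * Y * dissipation m K \<xi> \<eta>' z / \<zeta> powr (2*m - 2))"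
proof -
  define J where "J = {j. 1 \<le> j \<and> j \<le> K \<and> \<xi> (j - 1) \<le> (1 + \<Lambda>) * R}"
  have finJ: "finite J" by (auto simp: J_def)
  define D where "D = dissipation m K \<xi> \<eta>' z"
  define S where "S = \<zeta> powr (m + 1) + 128 * (1 + \<Lambda>) * Y * D / \<zeta> powr (2*m - 2)"
  have Y0: "0 \<le> Y" using Y energy_nonneg order_trans by blast
  have D0: "0 \<le> D" unfolding D_def by (rule dissipation_nonneg)
  have S0: "0 \<le> S" unfolding S_def using Y0 D0 ratio_ge_1 by simp
  have R': "0 < 2 * (1 + \<Lambda>) * R" using R ratio_ge_1 by simp
  have \<eta>: "1/2 \<le> \<eta>' i \<and> \<eta>' i \<le> 1" if "i \<le> j" "j \<in> J" for i j
  proof -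
    have "\<xi> (i - 1) \<le> \<xi> (j - 1)" using that by (intro xi_mono) (auto simp: J_def)
    moreover have "\<xi> (j - 1) \<le> 2 * (1 + \<Lambda>) * R / 2" "j \<le> K" using that by (auto simp: J_def algebra_simps)
    ultimately show ?thesis unfolding \<eta>'_def
      using that cutoff_ge_half[OF R', of i] cutoff_le_1[OF R', of i] by linarith
  qed
  \<comment> \<open>The exponent is split as 2m = (m + 1) + (m - 1): the first power is bounded by
    \<open>S\<close>, the second is the energy density.\<close>
  have "d j * z j powr (2 * m) \<le> 4 * S * (d j * (\<eta>' j)\<^sup>2 * z j powr (m - 1))" if j: "j \<in> J" for j
  proof -
    have "z j powr (3*m - 1) \<le> 128 * (1 + \<Lambda>) * energy m K \<xi> \<eta>' z * D"
      unfolding D_def using j \<eta> z by (intro interpolation m) (auto simp: J_def)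
    also have "\<dots> \<le> 128 * (1 + \<Lambda>) * Y * D"
      using Y D0 ratio_ge_1 by (intro mult_right_mono mult_left_mono) auto
    finally have int: "z j powr (3*m - 1) \<le> 128 * (1 + \<Lambda>) * Y * D" .
    have "z j powr (m + 1) \<le> S"
    proof (cases "z j \<le> \<zeta>")
      case True
      then have "z j powr (m + 1) \<le> \<zeta> powr (m + 1)" using z m by (intro powr_mono2) auto
      moreover have "0 \<le> 128 * (1 + \<Lambda>) * Y * D / \<zeta> powr (2*m - 2)"
        using Y0 D0 ratio_ge_1 by (intro divide_nonneg_nonneg mult_nonneg_nonneg) auto
      ultimately show ?thesis unfolding S_def by linarith
    next
      case False
      have "z j powr (m + 1) * \<zeta> powr (2*m - 2) \<le> z j powr (m + 1) * z j powr (2*m - 2)"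
        using False \<zeta> m by (intro mult_left_mono powr_mono2) auto
      also have "\<dots> = z j powr (3*m - 1)" by (simp flip: powr_add)
      finally have "z j powr (m + 1) \<le> 128 * (1 + \<Lambda>) * Y * D / \<zeta> powr (2*m - 2)"
        using int \<zeta> by (simp add: field_simps)
      then show ?thesis unfolding S_def using \<zeta> by (simp add: add_increasing)
    qed
    moreover have "z j powr (m - 1) \<le> 4 * (\<eta>' j)\<^sup>2 * z j powr (m - 1)"
    proof -
      have "(1/2)\<^sup>2 \<le> (\<eta>' j)\<^sup>2" using \<eta>[of j j] j by (intro power_mono) auto
      then have "1 \<le> 4 * (\<eta>' j)\<^sup>2" by (simp add: power2_eq_square)
      then show ?thesis
        using mult_right_mono[of 1 "4 * (\<eta>' j)\<^sup>2" "z j powr (m - 1)"] by simp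
    qed
    ultimately have "d j * (z j powr (m + 1) * z j powr (m - 1))
        \<le> d j * (S * (4 * (\<eta>' j)\<^sup>2 * z j powr (m - 1)))"
      using d_nonneg S0 by (intro mult_left_mono mult_mono) auto
    then show ?thesis by (simp add: algebra_simps flip: powr_add)
  qed
  then have "(\<Sum>j\<in>J. d j * z j powr (2 * m)) \<le> (\<Sum>j\<in>J. 4 * S * (d j * (\<eta>' j)\<^sup>2 * z j powr (m - 1)))"
    by (rule sum_mono)
  also have "\<dots> \<le> 4 * S * energy m K \<xi> \<eta>' z"
    unfolding energy_def sum_distrib_left
    using S0 d_nonneg by (intro sum_mono2) (auto simp: J_def)
  also have "\<dots> \<le> 4 * S * Y" using Y S0 by (intro mult_left_mono) auto
  finally have "2 * \<Lambda> / R\<^sup>2 * (\<Sum>j\<in>J. d j * z j powr (2 * m)) \<le> 2 * \<Lambda> / R\<^sup>2 * (4 * S * Y)"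
    using ratio_ge_1 by (intro mult_left_mono) auto
  then show ?thesis
    using cutoff_error_le_sum[OF R z, of m] unfolding S_def D_def J_def by (simp add: algebra_simps)
qed

end

subsection \<open>Propagation of the energy bound across scales\<close>

lemma summation_by_parts:
  fixes a v :: "nat \<Rightarrow> real"
  shows "(\<Sum>j=1..n. a j * (v j - v (j - 1))) = v n * a (Suc n) - v 0 * a 0 - (\<Sum>k\<le>n. v k * (a (Suc k) - a k))"
  by (induction n) (simp_all add: algebra_simps)

lemma has_real_derivative_le_imp_le:
  fixes f :: "real \<Rightarrow> real"
  assumes "0 \<le> t" and der: "\<And>s. 0 \<le> s \<Longrightarrow> s \<le> t \<Longrightarrow> (f has_real_derivative f' s) (at s within {0..t})"
    and le: "\<And>s. 0 \<le> s \<Longrightarrow> s \<le> t \<Longrightarrow> f' s \<le> c"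
  shows "f t \<le> f 0 + c * t"
proof -
  have "\<exists>s\<in>{0..t}. f t - f 0 = f' s * (t - 0)"
    using assms(1) der by (intro mvt_very_simple) (auto simp: has_field_derivative_def)
  then obtain s where "s \<in> {0..t}" "f t - f 0 = f' s * t" by auto
  moreover from this have "f' s * t \<le> c * t" using le assms(1) by (intro mult_right_mono) auto
  ultimately show ?thesis by linarith
qed

section \<open>Time evolution of the local energies\<close>

locale discrete_pme = mesh +
  fixes m :: real and x :: "real \<Rightarrow> nat \<Rightarrow> real"
  assumes m: "1 < m" and solution: "discrete_pme_solution m K \<xi> x"
begin

abbreviation "z t \<equiv> density K \<xi> (x t)"
abbreviation "E \<eta> t \<equiv> energy m K \<xi> \<eta> (z t)"
abbreviation "D \<eta> t \<equiv> dissipation m K \<xi> \<eta> (z t)"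
abbreviation "W \<eta> t \<equiv> integral {0..t} (D \<eta>)"

definition vel :: "real \<Rightarrow> nat \<Rightarrow> real" where
  "vel t k = - ((z t (Suc k) powr m - z t k powr m) / \<delta> k)"

lemma x_less: "0 \<le> t \<Longrightarrow> k < K \<Longrightarrow> x t k < x t (Suc k)"
  using solution by (auto simp: discrete_pme_solution_def)

lemma x_deriv: "0 \<le> t \<Longrightarrow> k \<le> K \<Longrightarrow> ((\<lambda>s. x s k) has_real_derivative vel t k) (at t within {0..})"
  using solution by (auto simp: discrete_pme_solution_def vel_def)

lemma z_outside: "z t 0 = 0" "z t (Suc K) = 0"
  by (auto simp: density_def)

lemma z_eq: "1 \<le> j \<Longrightarrow> j \<le> K \<Longrightarrow> z t j = d j / (x t j - x t (j - 1))"
  by (auto simp: density_def half_width_def)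

lemma z_pos: "0 \<le> t \<Longrightarrow> 1 \<le> j \<Longrightarrow> j \<le> K \<Longrightarrow> 0 < z t j"
  using x_less[of t "j - 1"] d_pos[of j] by (auto simp: z_eq)

lemma z_nonneg: "0 \<le> t \<Longrightarrow> 0 \<le> z t j"
  using z_pos[of t j] by (cases "1 \<le> j \<and> j \<le> K") (auto simp: density_def)

lemma z_powr_deriv:
  assumes "0 \<le> t" "1 \<le> j" "j \<le> K"
  shows "((\<lambda>s. z s j powr (m - 1)) has_real_derivative
    - ((m - 1) * z t j powr m / d j * (vel t j - vel t (j - 1)))) (at t within {0..})"
proof -
  define g where "g s = x s j - x s (j - 1)" for s
  have gpos: "g t > 0" using x_less[of t "j - 1"] assms by (simp add: g_def)
  have dpos: "d j > 0" using d_pos assms by simp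
  have z: "z s j = d j / g s" for s using z_eq assms by (simp add: g_def)
  have zp: "z t j > 0" using z_pos assms by simp
  have "(g has_real_derivative vel t j - vel t (j - 1)) (at t within {0..})"
    unfolding g_def using assms by (intro DERIV_diff x_deriv) auto
  then have "((\<lambda>s. z s j) has_real_derivative - (d j * (vel t j - vel t (j - 1)) / (g t)\<^sup>2)) (at t within {0..})"
    unfolding z using gpos
    by (auto intro!: derivative_eq_intros simp: power2_eq_square field_simps)
  from DERIV_chain2[OF has_real_derivative_powr[OF zp, of "m - 1"] this]
  have 1: "((\<lambda>s. z s j powr (m - 1)) has_real_derivative
     (m - 1) * z t j powr (m - 1 - 1) * - (d j * (vel t j - vel t (j - 1)) / (g t)\<^sup>2)) (at t within {0..})" .
  have "z t j powr m = z t j powr (m - 1 - 1) * (z t j)\<^sup>2"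
    using zp by (simp flip: powr_add powr_numeral)
  also have "(z t j)\<^sup>2 = d j * (d j / (g t)\<^sup>2)" by (simp add: z power2_eq_square)
  finally have "z t j powr m / d j = z t j powr (m - 1 - 1) * (d j / (g t)\<^sup>2)" using dpos by simp
  then have "(m - 1) * z t j powr (m - 1 - 1) * - (d j * (vel t j - vel t (j - 1)) / (g t)\<^sup>2)
      = - ((m - 1) * z t j powr m / d j * (vel t j - vel t (j - 1)))"
    by (metis (no_types, opaque_lifting) mult.assoc mult_minus_right times_divide_eq_left times_divide_eq_right)
  with 1 show ?thesis by simp
qed

text \<open>Summation by parts leaves no boundary terms, since the density vanishes in the
  fictitious cells. The remaining sum over nodes is then completed to squares.\<close>

lemma energy_deriv:
  assumes t: "0 \<le> t"
  shows "(E \<eta> has_real_derivative (m - 1) * (cutoff_error m K \<xi> \<eta> (z t) - D \<eta> t)) (at t within {0..})"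
proof -
  define a where "a j = (\<eta> j)\<^sup>2 * z t j powr m" for j
  define v where "v = vel t"
  have "(E \<eta> has_real_derivative
      (\<Sum>j=1..K. d j * (\<eta> j)\<^sup>2 * - ((m - 1) * z t j powr m / d j * (v j - v (j - 1))))) (at t within {0..})"
    unfolding energy_def v_def using t by (intro DERIV_sum DERIV_cmult z_powr_deriv) auto
  also have "(\<Sum>j=1..K. d j * (\<eta> j)\<^sup>2 * - ((m - 1) * z t j powr m / d j * (v j - v (j - 1))))
      = - (m - 1) * (\<Sum>j=1..K. a j * (v j - v (j - 1)))"
    unfolding sum_distrib_left
  proof (intro sum.cong refl)
    fix j assume "j \<in> {1..K}"
    then have "d j > 0" using d_pos by simp
    then have "d j * (\<eta> j)\<^sup>2 * - ((m - 1) * z t j powr m / d j * (v j - v (j - 1)))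
        = - ((\<eta> j)\<^sup>2 * ((m - 1) * z t j powr m * (v j - v (j - 1))))"
      by simp
    also have "\<dots> = - (m - 1) * (a j * (v j - v (j - 1)))"
      by (simp add: a_def algebra_simps)
    finally show "d j * (\<eta> j)\<^sup>2 * - ((m - 1) * z t j powr m / d j * (v j - v (j - 1)))
        = - (m - 1) * (a j * (v j - v (j - 1)))" .
  qed
  also have "(\<Sum>j=1..K. a j * (v j - v (j - 1))) = - (\<Sum>k\<le>K. v k * (a (Suc k) - a k))"
    unfolding summation_by_parts by (simp add: a_def z_outside)
  also have "\<dots> = D \<eta> t - cutoff_error m K \<xi> \<eta> (z t)"
    unfolding dissipation_def cutoff_error_def sum_negf[symmetric] sum_subtractf[symmetric]
  proof (intro sum.cong refl)
    fix k
    have identity: "(A\<^sup>2 * f - B\<^sup>2 * g) * (f - g) = (A * f - B * g)\<^sup>2 - g * f * (A - B)\<^sup>2" for A B f g :: real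
      by (simp add: power2_eq_square algebra_simps)
    have "- (v k * (a (Suc k) - a k)) = ((a (Suc k) - a k) * (z t (Suc k) powr m - z t k powr m)) / \<delta> k"
      by (simp add: v_def vel_def mult.commute)
    then show "- (v k * (a (Suc k) - a k)) = (\<eta> (Suc k) * z t (Suc k) powr m - \<eta> k * z t k powr m)\<^sup>2 / \<delta> k
        - z t k powr m * z t (Suc k) powr m * (\<eta> (Suc k) - \<eta> k)\<^sup>2 / \<delta> k"
      unfolding a_def identity by (simp add: diff_divide_distrib)
  qed
  finally show ?thesis by (simp add: algebra_simps)
qed

lemma z_powr_continuous: "continuous_on {0..} (\<lambda>s. z s j powr m)"
proof (cases "1 \<le> j \<and> j \<le> K")
  case True
  have cont: "continuous_on {0..} (\<lambda>s. x s k)" if "k \<le> K" for k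
    using x_deriv that by (intro DERIV_continuous_on[where D = "\<lambda>t. vel t k"]) auto
  have "continuous_on {0..} (\<lambda>s. z s j)"
    unfolding z_eq[OF conjunct1[OF True] conjunct2[OF True]]
    using x_less[of _ "j - 1"] True
    by (intro continuous_intros cont) fastforce+
  then show ?thesis using z_pos True by (intro continuous_intros) fastforce+
qed (auto simp: density_def)

lemma dissipation_continuous: "continuous_on {0..} (D \<eta>)"
  unfolding dissipation_def using node_width_pos
  by (intro continuous_on_sum continuous_intros z_powr_continuous) fastforce+

lemma W_deriv:
  assumes "0 \<le> s" "s \<le> t"
  shows "(W \<eta> has_real_derivative D \<eta> s) (at s within {0..t})"
  using assms by (intro integral_has_real_derivative continuous_on_subset[OF dissipation_continuous]) auto

text \<open>The error may be paid for by the dissipation of another cutoff \<open>\<eta>'\<close>,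
  which later lives at a larger scale. Hence two dissipation integrals appear and neither is
  absorbed here.\<close>

lemma energy_inequality:
  assumes "0 \<le> t" and err: "\<And>s. 0 \<le> s \<Longrightarrow> s \<le> t \<Longrightarrow> cutoff_error m K \<xi> \<eta> (z s) \<le> \<theta> * D \<eta>' s + Q"
  shows "E \<eta> t + (m - 1) * W \<eta> t \<le> E \<eta> 0 + (m - 1) * (\<theta> * W \<eta>' t + Q * t)"
proof -
  let ?f = "\<lambda>s. E \<eta> s + (m - 1) * W \<eta> s - (m - 1) * (\<theta> * W \<eta>' s)"
  have "?f t \<le> ?f 0 + (m - 1) * Q * t"
  proof (rule has_real_derivative_le_imp_le[OF assms(1)])
    fix s assume s: "0 \<le> s" "s \<le> t"
    have "(E \<eta> has_real_derivative (m - 1) * (cutoff_error m K \<xi> \<eta> (z s) - D \<eta> s)) (at s within {0..t})"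
      by (rule DERIV_subset[OF energy_deriv]) (use s in auto)
    then show "(?f has_real_derivative (m - 1) * (cutoff_error m K \<xi> \<eta> (z s) - D \<eta> s) + (m - 1) * D \<eta> s
        - (m - 1) * (\<theta> * D \<eta>' s)) (at s within {0..t})"
      by (intro DERIV_diff DERIV_add DERIV_cmult W_deriv s)
    have "(m - 1) * cutoff_error m K \<xi> \<eta> (z s) \<le> (m - 1) * (\<theta> * D \<eta>' s + Q)"
      using err[OF s] m by (intro mult_left_mono) auto
    then show "(m - 1) * (cutoff_error m K \<xi> \<eta> (z s) - D \<eta> s) + (m - 1) * D \<eta> s
        - (m - 1) * (\<theta> * D \<eta>' s) \<le> (m - 1) * Q"
      by (simp add: algebra_simps)
  qed
  then show ?thesis by (simp add: algebra_simps)
qed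

lemma W_nonneg: "0 \<le> W \<eta> t"
  by (cases "D \<eta> integrable_on {0..t}")
    (auto intro: integral_nonneg simp: dissipation_nonneg not_integrable_integral)

text \<open>For \<open>R < 1\<close> the cutoff sees only the cells up to the last one starting
  within \<open>R\<close>, and that one ends before \<open>(1 + \<Lambda>) * R\<close> by
  \<open>xi_step\<close>. For \<open>R \<ge> 1\<close> all cells count and the total mass 1 takes
  its place.\<close>

lemma energy_initial_le:
  assumes "0 \<le> b" "0 \<le> \<alpha>" and init: "\<And>k. 1 \<le> k \<Longrightarrow> k \<le> K \<Longrightarrow> (\<Sum>j=1..k. d j * z 0 j powr (m - 1)) \<le> b * \<xi> k powr \<alpha>"
    and R: "\<xi> 1 \<le> R" "0 < R"
  shows "E (cutoff \<xi> R) 0 \<le> b * ((1 + \<Lambda>) * R) powr \<alpha>"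
proof -
  define I where "I = {k. 1 \<le> k \<and> k \<le> K \<and> \<xi> (k - 1) \<le> R}"
  have I: "finite I" "1 \<in> I" using K_pos R xi_0 by (auto simp: I_def)
  define n where "n = Max I"
  have n: "n \<in> I" using I Max_in unfolding n_def by blast
  have summand_le: "d j * (cutoff \<xi> R j)\<^sup>2 * z 0 j powr (m - 1) \<le> d j * z 0 j powr (m - 1)" if "j \<le> K" for j
  proof -
    have "(cutoff \<xi> R j)\<^sup>2 \<le> 1"
      using cutoff_nonneg cutoff_le_1[OF R(2) that] by (simp add: power_le_one)
    then show ?thesis
      using d_nonneg[of j] mult_left_le[of "(cutoff \<xi> R j)\<^sup>2" "d j * z 0 j powr (m - 1)"]
      by (simp add: mult.commute mult.left_commute)
  qed
  show ?thesis
  proof (cases "R \<ge> 1")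
    case True
    have "E (cutoff \<xi> R) 0 \<le> b * \<xi> K powr \<alpha>"
      unfolding energy_def using summand_le K_pos by (intro order_trans[OF sum_mono init]) auto
    also have "\<dots> \<le> b * ((1 + \<Lambda>) * R) powr \<alpha>"
    proof (intro mult_left_mono powr_mono2)
      show "\<xi> K \<le> (1 + \<Lambda>) * R" using True ratio_ge_1 mult_mono[of 1 "1 + \<Lambda>" 1 R] by (simp add: xi_K)
    qed (use assms in \<open>auto simp: xi_K\<close>)
    finally show ?thesis .
  next
    case False
    have zero: "cutoff \<xi> R j = 0" if "j \<in> {1..K} - {1..n}" for j
    proof -
      have "j \<notin> I" using that Max_ge[OF I(1)] unfolding n_def by fastforce
      then have "R < \<xi> (j - 1)" using that by (auto simp: I_def)
      then show ?thesis using False R by (simp add: cutoff_def field_simps)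
    qed
    have "E (cutoff \<xi> R) 0 = (\<Sum>j=1..n. d j * (cutoff \<xi> R j)\<^sup>2 * z 0 j powr (m - 1))"
      unfolding energy_def using zero n by (intro sum.mono_neutral_right) (auto simp: I_def)
    also have "\<dots> \<le> (\<Sum>j=1..n. d j * z 0 j powr (m - 1))"
      using n summand_le by (intro sum_mono) (auto simp: I_def)
    also have "\<dots> \<le> b * \<xi> n powr \<alpha>" using n by (intro init) (auto simp: I_def)
    also have "\<dots> \<le> b * ((1 + \<Lambda>) * R) powr \<alpha>"
      using n assms xi_nonneg xi_step by (intro mult_left_mono powr_mono2) (auto simp: I_def)
    finally show ?thesis .
  qed
qed

text \<open>The constant \<open>B = 2 * A\<close> is a budget: \<open>A\<close> for the initial
  energy, \<open>A / 2\<close> for dissipation inherited from scale \<open>M * R\<close>, and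
  \<open>A / 2\<close> for the remainder accumulated in time. Large \<open>\<kappa>\<close> secures
  the second item, small \<open>C\<close> the third. The bound does not deteriorate with the number
  \<open>n\<close> of scales.\<close>

lemma energy_bound:
  fixes A B M \<alpha> \<theta> \<kappa> C b T :: real
  defines "\<alpha> \<equiv> (3 * m - 1) / (m + 1)" and "A \<equiv> (1 + \<Lambda>) powr \<alpha>" and "B \<equiv> 2 * A" and "M \<equiv> 2 * (1 + \<Lambda>)"
    and "\<theta> \<equiv> M powr (- \<alpha>) / 4"
  assumes b: "0 < b"
    and init: "\<And>k. 1 \<le> k \<Longrightarrow> k \<le> K \<Longrightarrow> (\<Sum>j=1..k. d j * z 0 j powr (m - 1)) \<le> b * \<xi> k powr \<alpha>"
    and \<kappa>: "0 < \<kappa>" "1024 * \<Lambda> * (1 + \<Lambda>) * (B * M powr \<alpha>)\<^sup>2 \<le> \<theta> * \<kappa> powr (2 * m - 2)"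
    and C: "32 * (m - 1) * \<Lambda> * M powr \<alpha> * \<kappa> powr (m + 1) * C \<le> 1"
    and T: "T \<le> C * b powr (- ((m + 1) / (m - 1)))"
    and R: "\<xi> 1 \<le> R" "1 \<le> M ^ n * R" and t: "0 \<le> t" "t \<le> T"
  shows "E (cutoff \<xi> R) t + (m - 1) * W (cutoff \<xi> R) t \<le> B * b * R powr \<alpha>"
  using R t
proof (induction n arbitrary: R t)
  case 0
  have \<alpha>: "\<alpha> > 0" using m by (simp add: \<alpha>_def)
  have "cutoff \<xi> R = (\<lambda>_. 1)" using 0 by (auto simp: cutoff_def)
  then have "cutoff_error m K \<xi> (cutoff \<xi> R) (z s) \<le> 0 * D (cutoff \<xi> R) s + 0" for s
    by (simp add: cutoff_error_def)
  then have "E (cutoff \<xi> R) t + (m - 1) * W (cutoff \<xi> R) t \<le> E (cutoff \<xi> R) 0 + (m - 1) * (0 * W (cutoff \<xi> R) t + 0 * t)"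
    by (intro energy_inequality 0)
  also have "\<dots> \<le> b * ((1 + \<Lambda>) * R) powr \<alpha>"
    using energy_initial_le[of b \<alpha> R] b \<alpha> init 0 by simp
  also have "\<dots> = A * b * R powr \<alpha>" using 0 ratio_ge_1 by (simp add: A_def powr_mult)
  also have "\<dots> \<le> B * b * R powr \<alpha>" using b by (intro mult_right_mono) (auto simp: A_def B_def)
  finally show ?case .
next
  case (Suc n)
  let ?\<eta> = "cutoff \<xi> R" and ?\<eta>' = "cutoff \<xi> (M * R)"
  have \<alpha>: "\<alpha> > 0" using m by (simp add: \<alpha>_def)
  have \<xi>1: "0 < \<xi> 1" using xi_less[of 0] xi_0 K_pos by simp
  then have Rpos: "0 < R" using Suc.prems by simp
  have A: "A > 0" and B: "B > 0" and M: "M > 1" and \<theta>: "\<theta> > 0"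
    using ratio_ge_1 by (auto simp: A_def B_def M_def \<theta>_def)
  have MR: "R \<le> M * R" using M Rpos by simp
  have IH: "E ?\<eta>' s + (m - 1) * W ?\<eta>' s \<le> B * b * (M * R) powr \<alpha>" if "0 \<le> s" "s \<le> T" for s
    using Suc.IH[of "M * R" s] Suc.prems that MR by (simp add: mult_ac)
  define Y where "Y = B * b * (M * R) powr \<alpha>"
  have Ypos: "Y > 0" using B b M Rpos by (simp add: Y_def)
  have Y_eq: "Y = B * M powr \<alpha> * b * R powr \<alpha>" using M Rpos by (simp add: Y_def powr_mult)
  \<comment> \<open>The powers of \<open>R\<close> and \<open>b\<close> are dictated by scaling:
    \<open>R\<close> cancels in the coefficient of the dissipation (\<open>main\<close>) and in the
    quotient of \<open>\<zeta> powr (m + 1)\<close> by \<open>R\<^sup>2\<close>, while the surviving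
    power of \<open>b\<close> is offset by the length of the time interval.\<close>
  define \<zeta> where "\<zeta> = \<kappa> * b powr (1 / (m - 1)) * R powr (2 / (m + 1))"
  have \<zeta>: "0 < \<zeta>" using \<kappa> b Rpos by (simp add: \<zeta>_def)
  have \<zeta>1: "\<zeta> powr (m + 1) = \<kappa> powr (m + 1) * b powr ((m + 1) / (m - 1)) * R\<^sup>2"
  proof -
    have e: "1 / (m - 1) * (m + 1) = (m + 1) / (m - 1)" "2 / (m + 1) * (m + 1) = 2"
      using m by (simp_all add: field_simps)
    have "\<zeta> powr (m + 1) = \<kappa> powr (m + 1) * b powr ((m + 1) / (m - 1)) * R powr 2"
      using \<kappa> b Rpos unfolding \<zeta>_def by (simp only: powr_mult powr_powr e)
    then show ?thesis using Rpos by simp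
  qed
  have \<zeta>2: "\<zeta> powr (2*m - 2) = \<kappa> powr (2*m - 2) * b\<^sup>2 * (R powr \<alpha>)\<^sup>2 / R\<^sup>2"
  proof -
    have e1: "1 / (m - 1) * (2*m - 2) = 2" using m by (simp add: field_simps)
    have e2: "2 / (m + 1) * (2*m - 2) = 2 * \<alpha> - 2" using m by (simp add: \<alpha>_def field_simps)
    have "\<zeta> powr (2*m - 2) = \<kappa> powr (2*m - 2) * b powr 2 * R powr (2 * \<alpha> - 2)"
      using \<kappa> b Rpos unfolding \<zeta>_def by (simp only: powr_mult powr_powr e1 e2)
    also have "R powr (2 * \<alpha> - 2) = (R powr \<alpha>)\<^sup>2 / R\<^sup>2"
      using Rpos by (simp add: powr_diff power2_eq_square flip: powr_add)
    finally show ?thesis using b by simp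
  qed
  define Q where "Q = 8 * \<Lambda> * Y / R\<^sup>2 * \<zeta> powr (m + 1)"
  have main: "8 * \<Lambda> * Y / R\<^sup>2 * (128 * (1 + \<Lambda>) * Y) / \<zeta> powr (2*m - 2) \<le> \<theta>"
  proof -
    have "8 * \<Lambda> * Y / R\<^sup>2 * (128 * (1 + \<Lambda>) * Y)
        = 1024 * \<Lambda> * (1 + \<Lambda>) * (B * M powr \<alpha>)\<^sup>2 * (b\<^sup>2 * (R powr \<alpha>)\<^sup>2 / R\<^sup>2)"
      by (simp add: Y_eq power2_eq_square)
    also have "\<dots> \<le> \<theta> * \<kappa> powr (2 * m - 2) * (b\<^sup>2 * (R powr \<alpha>)\<^sup>2 / R\<^sup>2)"
      using \<kappa> by (intro mult_right_mono) auto
    also have "\<dots> = \<theta> * \<zeta> powr (2*m - 2)" by (simp add: \<zeta>2)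
    finally show ?thesis by (subst pos_divide_le_eq) (use \<zeta> in auto)
  qed
  have err: "cutoff_error m K \<xi> ?\<eta> (z s) \<le> \<theta> * D ?\<eta>' s + Q" if s: "0 \<le> s" "s \<le> t" for s
  proof -
    have "0 \<le> (m - 1) * W ?\<eta>' s" using m W_nonneg by simp
    then have "E ?\<eta>' s \<le> Y" using IH[of s] s Suc.prems by (simp add: Y_def)
    then have "cutoff_error m K \<xi> ?\<eta> (z s) \<le> 8 * \<Lambda> * Y / R\<^sup>2 *
      (\<zeta> powr (m + 1) + 128 * (1 + \<Lambda>) * Y * D ?\<eta>' s / \<zeta> powr (2*m - 2))"
      unfolding M_def using m Rpos Suc.prems z_nonneg[OF s(1)] z_outside \<zeta>
      by (intro cutoff_error_le) auto
    also have "\<dots> = 8 * \<Lambda> * Y / R\<^sup>2 * (128 * (1 + \<Lambda>) * Y) / \<zeta> powr (2*m - 2) * D ?\<eta>' s + Q"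
      by (simp add: Q_def distrib_left mult_ac)
    also have "\<dots> \<le> \<theta> * D ?\<eta>' s + Q"
      using main dissipation_nonneg by (intro add_right_mono mult_right_mono) auto
    finally show ?thesis .
  qed
  have "E ?\<eta> t + (m - 1) * W ?\<eta> t \<le> E ?\<eta> 0 + (m - 1) * (\<theta> * W ?\<eta>' t + Q * t)"
    using Suc.prems err by (intro energy_inequality) auto
  also have "\<dots> = E ?\<eta> 0 + \<theta> * ((m - 1) * W ?\<eta>' t) + (m - 1) * Q * t" by (simp add: algebra_simps)
  also have "E ?\<eta> 0 \<le> A * (b * R powr \<alpha>)"
  proof -
    have "E ?\<eta> 0 \<le> b * ((1 + \<Lambda>) * R) powr \<alpha>"
      using energy_initial_le[of b \<alpha> R] b \<alpha> init Suc.prems Rpos by simp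
    also have "\<dots> = A * (b * R powr \<alpha>)" using Rpos ratio_ge_1 by (simp add: A_def powr_mult)
    finally show ?thesis .
  qed
  \<comment> \<open>The factor \<open>M powr (- \<alpha>)\<close> in \<open>\<theta>\<close> undoes
    the growth of the bound from \<open>R\<close> to \<open>M * R\<close>; the remaining quarter of
    \<open>B\<close> is \<open>A / 2\<close>.\<close>
  also have "\<theta> * ((m - 1) * W ?\<eta>' t) \<le> A / 2 * (b * R powr \<alpha>)"
  proof -
    have "(m - 1) * W ?\<eta>' t \<le> Y"
      using IH[of t] Suc.prems energy_nonneg[of m ?\<eta>' "z t"] by (simp add: Y_def)
    then have "\<theta> * ((m - 1) * W ?\<eta>' t) \<le> \<theta> * Y" using \<theta> by (intro mult_left_mono) auto
    also have "\<dots> = (M powr (- \<alpha>) * M powr \<alpha>) * (A / 2 * (b * R powr \<alpha>))"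
      by (simp add: Y_eq \<theta>_def B_def)
    also have "M powr (- \<alpha>) * M powr \<alpha> = 1" using M by (simp flip: powr_add)
    finally show ?thesis by simp
  qed
  also have "(m - 1) * Q * t \<le> A / 2 * (b * R powr \<alpha>)"
  proof -
    let ?p = "(m + 1) / (m - 1)"
    have "(m - 1) * Q * t \<le> (m - 1) * Q * (C * b powr (- ?p))"
      using Suc.prems T m ratio_ge_1 Ypos by (intro mult_left_mono) (auto simp: Q_def)
    also have "\<dots> = 32 * (m - 1) * \<Lambda> * M powr \<alpha> * \<kappa> powr (m + 1) * C
        * (b powr ?p * b powr (- ?p)) * (A / 2 * (b * R powr \<alpha>))"
      using Rpos by (simp add: Q_def \<zeta>1 Y_eq B_def)
    also have "b powr ?p * b powr (- ?p) = 1" using b by (simp flip: powr_add)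
    also have "32 * (m - 1) * \<Lambda> * M powr \<alpha> * \<kappa> powr (m + 1) * C * 1 * (A / 2 * (b * R powr \<alpha>))
        \<le> 1 * (A / 2 * (b * R powr \<alpha>))"
      using C A b by (intro mult_right_mono) auto
    finally show ?thesis by simp
  qed
  finally show ?case by (simp add: B_def algebra_simps)
qed

section \<open>Displacement of the leftmost node\<close>

lemma first_cell_bound:
  assumes t: "0 \<le> t" and H: "0 \<le> H" "\<And>s. 0 \<le> s \<Longrightarrow> s \<le> t \<Longrightarrow> z s 1 powr (m - 1) \<le> H"
  shows "\<bar>x t 0 - x 0 0\<bar> \<le> 2 / \<xi> 1 * H powr (m / (m - 1)) * t"
proof -
  have \<xi>1: "0 < \<xi> 1" using xi_less[of 0] xi_0 K_pos by simp
  have \<delta>0: "\<delta> 0 = \<xi> 1 / 2" using K_pos by (simp add: node_width_def half_width_def xi_0)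
  have v: "vel s 0 = - (2 / \<xi> 1 * z s 1 powr m)" for s
    using z_outside(1) by (simp add: vel_def \<delta>0)
  have bound: "\<bar>vel s 0\<bar> \<le> 2 / \<xi> 1 * H powr (m / (m - 1))" if s: "0 \<le> s" "s \<le> t" for s
  proof -
    have "z s 1 powr m = (z s 1 powr (m - 1)) powr (m / (m - 1))" using m by (simp add: powr_powr)
    also have "\<dots> \<le> H powr (m / (m - 1))" using H s m by (intro powr_mono2) auto
    finally have "2 / \<xi> 1 * z s 1 powr m \<le> 2 / \<xi> 1 * H powr (m / (m - 1))"
      using \<xi>1 by (intro mult_left_mono) auto
    then show ?thesis using \<xi>1 by (simp add: v)
  qed
  have der: "((\<lambda>s. x s 0) has_real_derivative vel s 0) (at s within {0..t})" if "0 \<le> s" "s \<le> t" for s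
    by (rule DERIV_subset[OF x_deriv]) (use that in auto)
  have "x t 0 \<le> x 0 0 + 2 / \<xi> 1 * H powr (m / (m - 1)) * t"
    using bound by (intro has_real_derivative_le_imp_le[OF t der]) (auto simp: abs_le_iff)
  moreover have "- x t 0 \<le> - x 0 0 + 2 / \<xi> 1 * H powr (m / (m - 1)) * t"
    by (rule has_real_derivative_le_imp_le[OF t, where f = "\<lambda>s. - x s 0" and f' = "\<lambda>s. - vel s 0"])
      (use der bound in \<open>auto intro!: DERIV_minus simp: abs_le_iff\<close>)
  ultimately show ?thesis by (simp add: abs_le_iff)
qed

text \<open>The first cell is one term of the energy at scale \<open>\<xi> 1\<close>, so its density
  is bounded and with it the speed of the node. The resulting factor
  \<open>b powr (m / (m - 1)) * t\<close> becomes \<open>sqrt (b * t)\<close>: its square is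
  \<open>b * t\<close> times \<open>b powr ((m + 1) / (m - 1)) * t\<close>, which the time
  restriction controls.\<close>

lemma x_0_bound:
  fixes B \<alpha> b t :: real
  defines "\<alpha> \<equiv> (3 * m - 1) / (m + 1)"
  assumes B: "0 < B" "0 < b" and t: "0 \<le> t"
    and bound: "\<And>s. 0 \<le> s \<Longrightarrow> s \<le> t \<Longrightarrow> E (cutoff \<xi> (\<xi> 1)) s \<le> B * b * \<xi> 1 powr \<alpha>"
    and small: "B powr (2 * m / (m - 1)) * (b powr ((m + 1) / (m - 1)) * t) \<le> 1"
  shows "\<bar>x t 0 - x 0 0\<bar> \<le> 2 * \<xi> 1 powr ((m - 1) / (m + 1)) * sqrt (b * t)"
proof -
  have \<xi>1: "0 < \<xi> 1" using xi_less[of 0] xi_0 K_pos by simp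
  define H where "H = B * b * \<xi> 1 powr (\<alpha> - 1)"
  have "z s 1 powr (m - 1) \<le> H" if s: "0 \<le> s" "s \<le> t" for s
  proof -
    have "\<xi> 1 * z s 1 powr (m - 1) = (\<Sum>j\<in>{1}. d j * (cutoff \<xi> (\<xi> 1) j)\<^sup>2 * z s j powr (m - 1))"
      using K_pos xi_0 cutoff_1[of "\<xi> 1"] by (simp add: half_width_def)
    also have "\<dots> \<le> E (cutoff \<xi> (\<xi> 1)) s"
      unfolding energy_def using K_pos d_nonneg by (intro sum_mono2) auto
    also have "\<dots> \<le> B * b * \<xi> 1 powr \<alpha>" by (rule bound[OF s])
    also have "\<dots> = \<xi> 1 * H" using \<xi>1 by (simp add: H_def powr_diff)
    finally show ?thesis using \<xi>1 by simp
  qed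
  then have "\<bar>x t 0 - x 0 0\<bar> \<le> 2 / \<xi> 1 * H powr (m / (m - 1)) * t"
    using B t by (intro first_cell_bound) (auto simp: H_def)
  also have "H powr (m / (m - 1)) = (B powr (m / (m - 1)) * b powr (m / (m - 1))) * (\<xi> 1 powr ((m - 1) / (m + 1)) * \<xi> 1)"
  proof -
    \<comment> \<open>One full power of \<open>\<xi> 1\<close> is split off to cancel the
      \<open>1 / \<xi> 1\<close> in the speed; what is left is the exponent of the claim.\<close>
    have "\<alpha> - 1 = 2 * (m - 1) / (m + 1)" using m by (simp add: \<alpha>_def field_simps)
    then have "(\<alpha> - 1) * (m / (m - 1)) = 2 * m / (m + 1)" using m by (simp add: divide_simps)
    also have "\<dots> = (m - 1) / (m + 1) + 1" using m by (simp add: field_simps)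
    finally have "(\<alpha> - 1) * (m / (m - 1)) = (m - 1) / (m + 1) + 1" .
    then have "\<xi> 1 powr ((\<alpha> - 1) * (m / (m - 1))) = \<xi> 1 powr ((m - 1) / (m + 1)) * \<xi> 1"
      using \<xi>1 by (simp add: powr_add)
    then show ?thesis using B \<xi>1 by (simp add: H_def powr_mult powr_powr)
  qed
  also have "2 / \<xi> 1 * (B powr (m / (m - 1)) * b powr (m / (m - 1)) * (\<xi> 1 powr ((m - 1) / (m + 1)) * \<xi> 1)) * t
      = 2 * \<xi> 1 powr ((m - 1) / (m + 1)) * (B powr (m / (m - 1)) * b powr (m / (m - 1)) * t)"
    using \<xi>1 by simp
  also have "\<dots> \<le> 2 * \<xi> 1 powr ((m - 1) / (m + 1)) * sqrt (b * t)"
  proof (intro mult_left_mono real_le_rsqrt)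
    have e: "m / (m - 1) + m / (m - 1) = 2 * m / (m - 1)" by simp
    have e': "2 * m / (m - 1) = (m + 1) / (m - 1) + 1" using m by (simp add: field_simps)
    have "(B powr (m / (m - 1)) * b powr (m / (m - 1)) * t)\<^sup>2
        = B powr (2 * m / (m - 1)) * b powr (2 * m / (m - 1)) * t\<^sup>2"
      unfolding e[symmetric] powr_add by (simp add: power2_eq_square)
    also have "b powr (2 * m / (m - 1)) = b powr ((m + 1) / (m - 1)) * b"
      using B by (simp add: e' powr_add)
    also have "B powr (2 * m / (m - 1)) * (b powr ((m + 1) / (m - 1)) * b) * t\<^sup>2
        = B powr (2 * m / (m - 1)) * (b powr ((m + 1) / (m - 1)) * t) * (b * t)"
      by (simp add: power2_eq_square)
    also have "\<dots> \<le> 1 * (b * t)" using small B t by (intro mult_right_mono) auto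
    finally show "(B powr (m / (m - 1)) * b powr (m / (m - 1)) * t)\<^sup>2 \<le> b * t" by simp
  qed auto
  finally show ?thesis .
qed

end

subsection \<open>Initial data and conclusion\<close>

text \<open>Jensen's inequality for the m-th power: integrate the tangent line at the mean
  \<open>\<rho>\<close>, which lies below the power by Young's inequality with exponents m and m/(m
  - 1).\<close>

lemma powr_mean_le:
  fixes u :: "real \<Rightarrow> real"
  assumes "1 < m" "a < c" and cont: "continuous_on {a..c} u" and u: "\<And>y. 0 \<le> u y"
    and I: "0 < integral {a..c} u"
  shows "integral {a..c} u * (integral {a..c} u / (c - a)) powr (m - 1) \<le> integral {a..c} (\<lambda>y. u y powr m)"
proof -
  define I where "I = integral {a..c} u"
  define \<rho> where "\<rho> = I / (c - a)"
  have \<rho>: "\<rho> > 0" using assms by (simp add: \<rho>_def I_def)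
  have I_eq: "I = \<rho> * (c - a)" using assms by (simp add: \<rho>_def)
  have um: "(\<lambda>y. u y powr m) integrable_on {a..c}"
    using assms by (intro integrable_continuous_interval continuous_on_powr') auto
  have ui: "u integrable_on {a..c}" using cont by (rule integrable_continuous_interval)
  have tangent: "m * \<rho> powr (m - 1) * y \<le> y powr m + (m - 1) * \<rho> powr m" if "0 \<le> y" for y
  proof -
    have "y * \<rho> powr (m - 1) \<le> y powr m / m + (\<rho> powr (m - 1)) powr (m / (m - 1)) / (m / (m - 1))"
      using assms that by (intro Youngs_inequality) (auto simp: field_simps)
    also have "(\<rho> powr (m - 1)) powr (m / (m - 1)) = \<rho> powr m" using assms by (simp add: powr_powr)
    finally show ?thesis using assms by (simp add: field_simps)
  qed
  have "m * \<rho> powr (m - 1) * I = integral {a..c} (\<lambda>y. m * \<rho> powr (m - 1) * u y)"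
    by (simp add: I_def)
  also have "\<dots> \<le> integral {a..c} (\<lambda>y. u y powr m + (m - 1) * \<rho> powr m)"
    using tangent u um ui by (intro integral_le integrable_add integrable_on_mult_right integrable_const_ivl) auto
  also have "\<dots> = integral {a..c} (\<lambda>y. u y powr m) + (m - 1) * (\<rho> powr m * (c - a))"
    using assms by (subst integral_add[OF um integrable_const_ivl]) simp
  also have "\<rho> powr m * (c - a) = \<rho> powr (m - 1) * I"
    using \<rho> by (simp add: I_eq powr_diff)
  finally show ?thesis by (simp add: I_def[symmetric] \<rho>_def[symmetric] algebra_simps)
qed

text \<open>Jensen on each cell bounds the discrete energy of the first cells by the integral of
  \<open>u\<^sup>m\<close> up to the corresponding node, to which the supremum applies.\<close>

lemma initial_energy_le:
  fixes u :: "real \<Rightarrow> real" and m :: real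
  defines "\<alpha> \<equiv> (3 * m - 1) / (m + 1)"
  assumes m: "1 < m" and cont: "continuous_on UNIV u" and u: "\<And>y. 0 \<le> u y"
    and K: "2 \<le> K" and mesh: "is_mesh K \<xi>"
    and xbar: "xbar K = b" "\<And>k. k < K \<Longrightarrow> xbar k < xbar (Suc k)"
      "\<And>k. k \<le> K \<Longrightarrow> integral {xbar 0..xbar k} u = \<xi> k"
    and bdd: "bdd_above (moment_ratio m u (xbar 0) ` {xbar 0<..<b})"
    and bbar: "bbar = (SUP l\<in>{xbar 0<..<b}. moment_ratio m u (xbar 0) l)"
  shows "0 < bbar"
    and "1 \<le> k \<Longrightarrow> k \<le> K \<Longrightarrow>
      (\<Sum>j=1..k. half_width K \<xi> j * density K \<xi> xbar j powr (m - 1)) \<le> bbar * \<xi> k powr \<alpha>"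
proof -
  define V where "V l = integral {xbar 0..l} (\<lambda>y. u y powr m)" for l
  define S where "S k = (\<Sum>j=1..k. half_width K \<xi> j * density K \<xi> xbar j powr (m - 1))" for k
  have um: "continuous_on X (\<lambda>y. u y powr m)" for X
    using m u cont by (intro continuous_on_powr' continuous_on_subset[OF cont]) auto
  have ui: "u integrable_on {c..l}" and umi: "(\<lambda>y. u y powr m) integrable_on {c..l}" for c l
    using cont um by (auto intro!: integrable_continuous_interval intro: continuous_on_subset)
  have xmono: "xbar i \<le> xbar j" if "i \<le> j" "j \<le> K" for i j
    using that
  proof (induction j rule: dec_induct)
    case (step n)
    then show ?case using xbar(2)[of n] by simp
  qed simp
  have \<xi>_less: "\<xi> k < \<xi> (Suc k)" if "k < K" for k using mesh that by (simp add: is_mesh_def)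
  have \<xi>1: "0 < \<xi> 1" using \<xi>_less[of 0] mesh K by (simp add: is_mesh_def)
  have \<xi>_ge: "\<xi> 1 \<le> \<xi> k" if "1 \<le> k" "k \<le> K" for k
    using that
  proof (induction k rule: dec_induct)
    case (step n)
    then show ?case using \<xi>_less[of n] by simp
  qed simp
  have dens_pos: "0 < density K \<xi> xbar j" if "1 \<le> j" "j \<le> K" for j
    using that \<xi>_less[of "j - 1"] xbar(2)[of "j - 1"] by (simp add: density_def)
  have S_le: "S k \<le> V (xbar k)" if "k \<le> K" for k
    using that
  proof (induction k)
    case 0
    then show ?case by (simp add: S_def V_def)
  next
    case (Suc k)
    have "integral {xbar k..xbar (Suc k)} u = \<xi> (Suc k) - \<xi> k"
      using Henstock_Kurzweil_Integration.integral_combine[OF xmono[of 0 k] xmono[of k "Suc k"] ui]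
        xbar(3)[of k] xbar(3)[of "Suc k"] Suc.prems by simp
    then have "(\<xi> (Suc k) - \<xi> k) * ((\<xi> (Suc k) - \<xi> k) / (xbar (Suc k) - xbar k)) powr (m - 1)
        \<le> integral {xbar k..xbar (Suc k)} (\<lambda>y. u y powr m)"
      using powr_mean_le[of m "xbar k" "xbar (Suc k)" u] m u cont Suc.prems xbar(2)[of k] \<xi>_less[of k]
      by (auto intro: continuous_on_subset)
    then have "S (Suc k) \<le> S k + integral {xbar k..xbar (Suc k)} (\<lambda>y. u y powr m)"
      using Suc.prems by (simp add: S_def half_width_def density_def)
    also have "\<dots> \<le> V (xbar k) + integral {xbar k..xbar (Suc k)} (\<lambda>y. u y powr m)"
      using Suc by simp
    also have "\<dots> = V (xbar (Suc k))"
      unfolding V_def using Suc.prems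
      by (intro Henstock_Kurzweil_Integration.integral_combine xmono umi) auto
    finally show ?case .
  qed
  have x01: "xbar 0 < xbar 1" using xbar(2)[of 0] K by simp
  have x1b: "xbar 1 < b" using xbar(2)[of 1] xmono[of 2 K] K xbar(1) by (simp add: numeral_2_eq_2)
  \<comment> \<open>Restricting to \<open>l \<ge> xbar 1\<close> keeps the mass in the denominator
    of \<open>moment_ratio\<close> positive, so the quotient can be cleared.\<close>
  have V_le: "V l \<le> bbar * integral {xbar 0..l} u powr \<alpha>" if "xbar 1 \<le> l" "l < b" for l
  proof -
    have "integral {xbar 0..xbar 1} u \<le> integral {xbar 0..l} u"
      using that u ui by (intro integral_subset_le) auto
    then have pos: "0 < integral {xbar 0..l} u" using xbar(3)[of 1] \<xi>1 K by simp
    have "moment_ratio m u (xbar 0) l \<le> bbar"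
      unfolding bbar using that x01 by (intro cSUP_upper bdd) auto
    then show ?thesis using pos by (simp add: moment_ratio_def V_def \<alpha>_def pos_divide_le_eq)
  qed
  \<comment> \<open>Positivity of \<open>bbar\<close> comes from the energy of the first cell;
    \<open>K \<ge> 2\<close> places \<open>xbar 1\<close> strictly below \<open>b\<close>.\<close>
  have "0 < half_width K \<xi> 1 * density K \<xi> xbar 1 powr (m - 1)"
    using dens_pos[of 1] \<xi>_less[of 0] K by (simp add: half_width_def)
  also have "\<dots> = S 1" by (simp add: S_def)
  also have "\<dots> \<le> bbar * \<xi> 1 powr \<alpha>"
    using S_le[of 1] V_le[of "xbar 1"] x1b xbar(3)[of 1] K by simp
  finally show bbar_pos: "0 < bbar" using \<xi>1 by (simp add: zero_less_mult_iff)
  \<comment> \<open>The supremum omits the end point \<open>b\<close>, so the last node is reached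
    by continuity of \<open>V\<close>, using that the mass never exceeds 1.\<close>
  have Vb: "V b \<le> bbar"
  proof (rule continuous_le_on_closure[of "{xbar 1<..<b}" V])
    show "continuous_on (closure {xbar 1<..<b}) V"
      unfolding V_def using x1b x01
      by (intro continuous_on_subset[OF indefinite_integral_continuous_1[OF umi, of "xbar 0" b]]) auto
    show "b \<in> closure {xbar 1<..<b}" using x1b by simp
    fix l assume l: "l \<in> {xbar 1<..<b}"
    have "integral {xbar 0..l} u \<le> integral {xbar 0..xbar K} u"
      using l u ui xbar(1) by (intro integral_subset_le) auto
    then have "integral {xbar 0..l} u \<le> 1" using xbar(3)[of K] mesh by (simp add: is_mesh_def)
    moreover have "0 \<le> integral {xbar 0..l} u" using u ui by (intro integral_nonneg) auto
    ultimately have "integral {xbar 0..l} u powr \<alpha> \<le> 1" using m by (intro powr_le1) (auto simp: \<alpha>_def)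
    then have "bbar * integral {xbar 0..l} u powr \<alpha> \<le> bbar" using bbar_pos by (intro mult_left_le) auto
    then show "V l \<le> bbar" using V_le[of l] l by simp
  qed
  assume k: "1 \<le> k" "k \<le> K"
  have "V (xbar k) \<le> bbar * \<xi> k powr \<alpha>"
  proof (cases "k = K")
    case True
    then show ?thesis using Vb xbar(1) mesh by (simp add: is_mesh_def)
  next
    case False
    then have "xbar k < b" using xbar(2)[of k] xmono[of "Suc k" K] k xbar(1) by simp
    then show ?thesis using V_le[of "xbar k"] xmono[of 1 k] k xbar(3)[of k] by simp
  qed
  then show "(\<Sum>j=1..k. half_width K \<xi> j * density K \<xi> xbar j powr (m - 1)) \<le> bbar * \<xi> k powr \<alpha>"
    using S_le[of k] k by (simp add: S_def)
qed

lemma mesh_of_mesh_ratio: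
  assumes "is_mesh K \<xi>" "mesh_ratio K \<xi> = \<Lambda>" "1 \<le> \<Lambda>"
  shows "mesh K \<xi> \<Lambda>"
proof
  fix k assume k: "1 \<le> k" "k < K"
  have pos: "0 < half_width K \<xi> k" "0 < half_width K \<xi> (Suc k)"
    using assms(1) k by (auto simp: half_width_def is_mesh_def dest: spec[of _ "k - 1"])
  let ?f = "\<lambda>k. half_width K \<xi> (Suc k) / half_width K \<xi> k"
  let ?g = "\<lambda>k. half_width K \<xi> k / half_width K \<xi> (Suc k)"
  have "?f k \<le> Max (?f ` {1..K - 1})" "?g k \<le> Max (?g ` {1..K - 1})"
    using k by (auto intro!: Max_ge imageI)
  then have "?f k \<le> \<Lambda>" "?g k \<le> \<Lambda>"
    unfolding assms(2)[symmetric] mesh_ratio_def by linarith+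
  then show "half_width K \<xi> (Suc k) \<le> \<Lambda> * half_width K \<xi> k"
    "half_width K \<xi> k \<le> \<Lambda> * half_width K \<xi> (Suc k)"
    using pos by (simp_all add: pos_divide_le_eq)
qed (use assms in auto)

text \<open>All constants are fixed from \<open>m\<close> and \<open>\<Lambda>\<close> before mesh,
  solution and \<open>b\<close> appear, which is the uniformity claimed in the theorem.\<close>

lemma waiting_time_constant:
  fixes m \<Lambda> :: real
  defines "\<alpha> \<equiv> (3 * m - 1) / (m + 1)"
  assumes m: "1 < m" and \<Lambda>: "1 \<le> \<Lambda>"
  obtains C where "0 < C" and
    "\<And>K \<xi> x b t. discrete_pme K \<xi> \<Lambda> m x \<Longrightarrow> 0 < b \<Longrightarrow>
      (\<And>k. 1 \<le> k \<Longrightarrow> k \<le> K \<Longrightarrow>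
        (\<Sum>j=1..k. half_width K \<xi> j * density K \<xi> (x 0) j powr (m - 1)) \<le> b * \<xi> k powr \<alpha>) \<Longrightarrow>
      0 \<le> t \<Longrightarrow> t \<le> C * b powr (- ((m + 1) / (m - 1))) \<Longrightarrow>
      \<bar>x t 0 - x 0 0\<bar> \<le> 2 * \<xi> 1 powr ((m - 1) / (m + 1)) * sqrt (b * t)"
proof -
  define B where "B = 2 * (1 + \<Lambda>) powr \<alpha>"
  define M where "M = 2 * (1 + \<Lambda>)"
  define \<theta> where "\<theta> = M powr (- \<alpha>) / 4"
  \<comment> \<open>Chosen to give equality in the condition on \<open>\<kappa>\<close> in
    \<open>energy_bound\<close>.\<close>
  define \<kappa> where "\<kappa> = (1024 * \<Lambda> * (1 + \<Lambda>) * (B * M powr \<alpha>)\<^sup>2 / \<theta>) powr (1 / (2 * m - 2))"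
  define N where "N = 32 * (m - 1) * \<Lambda> * M powr \<alpha> * \<kappa> powr (m + 1)"
  \<comment> \<open>The first bound serves the remainder in \<open>energy_bound\<close>, the second
    the smallness condition in \<open>x_0_bound\<close>.\<close>
  define C where "C = min (1 / N) (B powr (- (2 * m / (m - 1))))"
  have pos: "0 < B" "1 < M" "0 < \<theta>" using \<Lambda> by (auto simp: B_def M_def \<theta>_def)
  then have \<kappa>: "0 < \<kappa>" using \<Lambda> by (auto simp: \<kappa>_def)
  have \<kappa>': "1024 * \<Lambda> * (1 + \<Lambda>) * (B * M powr \<alpha>)\<^sup>2 \<le> \<theta> * \<kappa> powr (2 * m - 2)"
    using pos \<Lambda> m by (simp add: \<kappa>_def powr_powr)
  have N: "0 < N" using m \<Lambda> pos \<kappa> by (simp add: N_def)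
  have C: "0 < C" "N * C \<le> 1" "B powr (2 * m / (m - 1)) * C \<le> 1"
  proof -
    show "0 < C" using N pos by (simp add: C_def)
    have "N * C \<le> N * (1 / N)" using N by (intro mult_left_mono) (auto simp: C_def)
    then show "N * C \<le> 1" using N by simp
    have "B powr (2 * m / (m - 1)) * C \<le> B powr (2 * m / (m - 1)) * B powr (- (2 * m / (m - 1)))"
      by (intro mult_left_mono) (auto simp: C_def)
    also have "\<dots> = 1" using pos by (simp flip: powr_add)
    finally show "B powr (2 * m / (m - 1)) * C \<le> 1" .
  qed
  show thesis
  proof (rule that[OF C(1)])
    fix K \<xi> x and b t :: real
    assume "discrete_pme K \<xi> \<Lambda> m x" and b: "0 < b"
      and init: "\<And>k. 1 \<le> k \<Longrightarrow> k \<le> K \<Longrightarrow>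
        (\<Sum>j=1..k. half_width K \<xi> j * density K \<xi> (x 0) j powr (m - 1)) \<le> b * \<xi> k powr \<alpha>"
      and t: "0 \<le> t" "t \<le> C * b powr (- ((m + 1) / (m - 1)))"
    interpret discrete_pme K \<xi> \<Lambda> m x by fact
    have \<xi>1: "0 < \<xi> 1" using xi_less[of 0] xi_0 K_pos by simp
    \<comment> \<open>The number of scales depends on the mesh, but no constant depends on
      it.\<close>
    obtain n where "1 / \<xi> 1 < M ^ n" using real_arch_pow pos by blast
    then have n: "1 \<le> M ^ n * \<xi> 1" using \<xi>1 by (simp add: field_simps)
    have bound: "E (cutoff \<xi> (\<xi> 1)) s \<le> B * b * \<xi> 1 powr \<alpha>" if "0 \<le> s" "s \<le> t" for s
    proof -
      have "E (cutoff \<xi> (\<xi> 1)) s + (m - 1) * W (cutoff \<xi> (\<xi> 1)) s \<le> B * b * \<xi> 1 powr \<alpha>"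
        using energy_bound[of b \<kappa> C t "\<xi> 1" n s] b init \<kappa> \<kappa>' C(2) t n that
        unfolding B_def M_def \<theta>_def N_def \<alpha>_def by simp
      then show ?thesis using m W_nonneg[of s "cutoff \<xi> (\<xi> 1)"]
        by (smt (verit) mult_nonneg_nonneg)
    qed
    show "\<bar>x t 0 - x 0 0\<bar> \<le> 2 * \<xi> 1 powr ((m - 1) / (m + 1)) * sqrt (b * t)"
    proof (rule x_0_bound[OF pos(1) b t(1)])
      have "b powr ((m + 1) / (m - 1)) * t \<le> b powr ((m + 1) / (m - 1)) * (C * b powr (- ((m + 1) / (m - 1))))"
        using t by (intro mult_left_mono) auto
      also have "\<dots> = C" using b by (simp add: powr_minus)
      finally have "B powr (2 * m / (m - 1)) * (b powr ((m + 1) / (m - 1)) * t) \<le> B powr (2 * m / (m - 1)) * C"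
        by (intro mult_left_mono) auto
      then show "B powr (2 * m / (m - 1)) * (b powr ((m + 1) / (m - 1)) * t) \<le> 1"
        using C(3) by simp
    qed (use bound in \<open>simp add: \<alpha>_def\<close>)
  qed
qed

theorem theorem1:
  fixes m \<Lambda>0 :: real
  assumes "m > 1" and "\<Lambda>0 \<ge> 1"
  shows "\<exists>C>0. \<forall>(u :: real \<Rightarrow> real) (a :: real) (b :: real) (K :: nat) (\<xi> :: nat \<Rightarrow> real)
            (xbar :: nat \<Rightarrow> real) (x :: real \<Rightarrow> nat \<Rightarrow> real) (bbar :: real).
      continuous_on UNIV u \<longrightarrow>
      (\<forall>y. 0 \<le> u y) \<longrightarrow>
      closure {y. u y \<noteq> 0} = {a..b} \<longrightarrow>
      (\<forall>y\<in>{a<..<b}. 0 < u y) \<longrightarrow>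
      integral {a..b} u = 1 \<longrightarrow>
      2 \<le> K \<longrightarrow>
      is_mesh K \<xi> \<longrightarrow>
      mesh_ratio K \<xi> = \<Lambda>0 \<longrightarrow>
      xbar 0 = a \<longrightarrow>
      xbar K = b \<longrightarrow>
      (\<forall>k<K. xbar k < xbar (Suc k)) \<longrightarrow>
      (\<forall>k\<le>K. integral {xbar 0..xbar k} u = \<xi> k) \<longrightarrow>
      discrete_pme_solution m K \<xi> x \<longrightarrow>
      (\<forall>k\<le>K. x 0 k = xbar k) \<longrightarrow>
      bdd_above (moment_ratio m u (xbar 0) ` {a<..<b}) \<longrightarrow>
      bbar = (SUP l\<in>{a<..<b}. moment_ratio m u (xbar 0) l) \<longrightarrow>
      (\<forall>t. 0 \<le> t \<and> t \<le> C * bbar powr (- ((m + 1) / (m - 1))) \<longrightarrow>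
         \<bar>x t 0 - xbar 0\<bar> \<le> 2 * (\<xi> 1 - \<xi> 0) powr ((m - 1) / (m + 1)) * sqrt (bbar * t))"
proof -
  obtain C where C: "0 < C" and bound:
    "\<And>K \<xi> x b t. discrete_pme K \<xi> \<Lambda>0 m x \<Longrightarrow> 0 < b \<Longrightarrow>
      (\<And>k. 1 \<le> k \<Longrightarrow> k \<le> K \<Longrightarrow>
        (\<Sum>j=1..k. half_width K \<xi> j * density K \<xi> (x 0) j powr (m - 1)) \<le> b * \<xi> k powr ((3 * m - 1) / (m + 1))) \<Longrightarrow>
      0 \<le> t \<Longrightarrow> t \<le> C * b powr (- ((m + 1) / (m - 1))) \<Longrightarrow>
      \<bar>x t 0 - x 0 0\<bar> \<le> 2 * \<xi> 1 powr ((m - 1) / (m + 1)) * sqrt (b * t)"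
    using waiting_time_constant[OF assms] by blast
  show ?thesis
  proof (intro exI[of _ C] conjI C allI impI, goal_cases)
    case (1 u a b K \<xi> xbar x bbar t)
    have bdd: "bdd_above (moment_ratio m u (xbar 0) ` {xbar 0<..<b})"
      and bbar: "bbar = (SUP l\<in>{xbar 0<..<b}. moment_ratio m u (xbar 0) l)"
      using 1 by simp_all
    have "continuous_on UNIV u" "\<And>y. 0 \<le> u y" "2 \<le> K" "is_mesh K \<xi>" "xbar K = b"
      "\<And>k. k < K \<Longrightarrow> xbar k < xbar (Suc k)" "\<And>k. k \<le> K \<Longrightarrow> integral {xbar 0..xbar k} u = \<xi> k"
      using 1 by simp_all
    note init = initial_energy_le[OF assms(1) this bdd bbar]
    interpret mesh K \<xi> \<Lambda>0 using mesh_of_mesh_ratio 1 assms by blast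
    have pme: "discrete_pme K \<xi> \<Lambda>0 m x"
      by unfold_locales (use 1 assms in auto)
    \<comment> \<open>The initial data agree with \<open>xbar\<close> only up to index
      \<open>K\<close>; beyond that the density is zero by definition.\<close>
    have dens: "density K \<xi> (x 0) j = density K \<xi> xbar j" for j
      using 1 by (auto simp: density_def)
    have "\<bar>x t 0 - x 0 0\<bar> \<le> 2 * \<xi> 1 powr ((m - 1) / (m + 1)) * sqrt (bbar * t)"
    proof (rule bound[OF pme])
      show "0 < bbar" using init(1) by blast
      show "(\<Sum>j=1..k. half_width K \<xi> j * density K \<xi> (x 0) j powr (m - 1))
          \<le> bbar * \<xi> k powr ((3 * m - 1) / (m + 1))" if "1 \<le> k" "k \<le> K" for k
        unfolding dens using init(2) that by blast
    qed (use 1 in auto)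
    then show ?case using 1 xi_0 by simp
  qed
qed

end
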